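(* If none of $B_0,B_1,B_2$ is equal to $[0,u]$, then we may choose $\{i,j,k\}=\{0,1,2\}$ such that $$0<b_{iL}\le b_{iR}=u,\qquad 0=b_{jL}\le b_{jR}<u,\qquad 0\le b_{kL}\le b_{kR}<u.$$ Then $N(\phi)$ has at most $5$ vertices if $b_{kL}>0$, and at most $4$ vertices if $b_{kL}=0$. If $b_{kL}>0$, the vertices, written as $(e_i,e_j)$, lie in $$\{(b_{jR},0),\ (b_{kR},u-b_{kR}),\ (b_{kL},u-b_{kL}),\ (0,u-b_{iL}),\ (0,0)\};$$ if $b_{kL}=0$, the third and fourth elements are replaced by $(0,u)$, i.e. the vertices lie in $$\{(b_{jR},0),\ (b_{kR},u-b_{kR}),\ (0,u),\ (0,0)\}.$$
   Context: Consider $x=P_0(t)/Q(t)$, $y=P_1(t)/Q(t)$ with $P_0,P_1,Q\in\mathbb{C}[t]$ having fixed supports and generic coefficients (the result holds for all coefficient vectors in some open dense subset of the coefficient space), $\gcd(P_i,Q)=1$ for $i=0,1$, and parameterization of degree $1$. Let $\phi\in\mathbb{C}[x,y]$ be the implicit equation (generator of the ideal of polynomials vanishing on the parameterization) and $N(\phi)$ its Newton polygon (convex hull of the exponent vectors occurring in $\phi$). Let $B_0,B_1,B_2$ be the Newton segments (convex hulls of the supports) of $P_0,P_1,Q$ respectively, and let $b_{lL}\le b_{lR}$ be the left and right endpoints of $B_l$, so $B_l=[b_{lL},b_{lR}]$ for $l=0,1,2$. Let $u=\max\{b_{0R},b_{1R},b_{2R}\}$. Coordinates: let $\Phi(x_0,x_1,x_2)$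 be the homogeneous implicit equation, of degree $u$, with $\phi(x,y)=\Phi(x,y,1)$. An exponent $(e_0,e_1)$ of $\phi$ corresponds to the exponent $(e_0,e_1,e_2)$ of $\Phi$ with $e_0+e_1+e_2=u$; a point of $N(\phi)$ is thus described by any two of the coordinates $e_0,e_1,e_2$, in particular by $(e_i,e_j)$, with the third given by $e_k=u-e_i-e_j$.
   Formalization: The choice with b_{kR}<u is asserted only if b_{0R}<u or b_{1R}<u; otherwise only b_{kR}≤u, since no strict choice exists then (e.g. B_0=B_1=[1,2], B_2=[0,1], u=2). The vertex claims are proved for every choice with b_{kR}≤u. *)

theory Defs
  imports "HOL-Analysis.Analysis" "HOL-Computational_Algebra.Computational_Algebra"
begin

text \<open>The index \<open>l\<close> ranges over \<open>{0, 1, 2}\<close>, for \<open>P\<^sub>0\<close>, \<open>P\<^sub>1\<close> and \<open>P\<^sub>2 = Q\<close>;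
  \<open>A l\<close> is the support of \<open>P\<^sub>l\<close>.  A coefficient vector is indexed by the pairs
  \<open>(l, a)\<close> with \<open>a \<in> A l\<close>.\<close>

definition coeff_index :: "(nat \<Rightarrow> nat set) \<Rightarrow> (nat \<times> nat) set" where
  "coeff_index A = Sigma {0, 1, 2} A"

text \<open>All coordinates of a coefficient vector are nonzero, so that the polynomials
  have exactly the prescribed supports.\<close>

definition coeff_space :: "(nat \<Rightarrow> nat set) \<Rightarrow> (nat \<times> nat \<Rightarrow> complex) topology" where
  "coeff_space A = product_topology (\<lambda>_. top_of_set (- {0})) (coeff_index A)"

definition open_dense_in :: "'a topology \<Rightarrow> 'a set \<Rightarrow> bool" where
  "open_dense_in T U \<longleftrightarrow> openin T U \<and> T closure_of U = topspace T"

definition supp_poly :: "(nat \<Rightarrow> nat set) \<Rightarrow> (nat \<times> nat \<Rightarrow> complex) \<Rightarrow> nat \<Rightarrow> complex poly" where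
  "supp_poly A c l = (\<Sum>a\<in>A l. monom (c (l, a)) a)"

definition newton_segment :: "nat set \<Rightarrow> real set" where
  "newton_segment S = convex hull (real ` S)"

text \<open>For a finite nonempty support, \<open>newton_segment (A l)\<close> is the interval from
  \<open>bL A l\<close> to \<open>bR A l\<close>.\<close>

definition bL :: "(nat \<Rightarrow> nat set) \<Rightarrow> nat \<Rightarrow> nat" where
  "bL A l = Min (A l)"

definition bR :: "(nat \<Rightarrow> nat set) \<Rightarrow> nat \<Rightarrow> nat" where
  "bR A l = Max (A l)"

definition max_deg :: "(nat \<Rightarrow> nat set) \<Rightarrow> nat" where
  "max_deg A = Max {bR A 0, bR A 1, bR A 2}"

definition param_point ::
    "complex poly \<Rightarrow> complex poly \<Rightarrow> complex poly \<Rightarrow> complex \<Rightarrow> complex \<times> complex" where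
  "param_point P0 P1 Q t = (poly P0 t / poly Q t, poly P1 t / poly Q t)"

text \<open>The degree of a parameterization is the number of parameter values over a
  generic point of its image.  Constant parameterizations have infinite fibres, of
  \<open>card\<close> zero, so they do not have any positive degree.\<close>

definition has_param_degree ::
    "complex poly \<Rightarrow> complex poly \<Rightarrow> complex poly \<Rightarrow> nat \<Rightarrow> bool" where
  "has_param_degree P0 P1 Q d \<longleftrightarrow>
     finite {t. poly Q t \<noteq> 0 \<and>
       card {s. poly Q s \<noteq> 0 \<and> param_point P0 P1 Q s = param_point P0 P1 Q t} \<noteq> d}"

text \<open>Elements of \<open>\<complex>[x, y]\<close> are represented as polynomials in \<open>y\<close> over \<open>\<complex>[x]\<close>: the
  coefficient of \<open>x\<^sup>a y\<^sup>b\<close> in \<open>f\<close> is \<open>coeff (coeff f b) a\<close>.\<close>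

definition poly2 :: "complex poly poly \<Rightarrow> complex \<times> complex \<Rightarrow> complex" where
  "poly2 f p = poly (poly f [:snd p:]) (fst p)"

definition vanishing_ideal ::
    "complex poly \<Rightarrow> complex poly \<Rightarrow> complex poly \<Rightarrow> complex poly poly set" where
  "vanishing_ideal P0 P1 Q =
     {f. \<forall>t. poly Q t \<noteq> 0 \<longrightarrow> poly2 f (param_point P0 P1 Q t) = 0}"

text \<open>The principal ideal generated by \<open>\<phi>\<close> is the set of multiples of \<open>\<phi>\<close>.\<close>

definition is_implicit_equation ::
    "complex poly \<Rightarrow> complex poly \<Rightarrow> complex poly \<Rightarrow> complex poly poly \<Rightarrow> bool" where
  "is_implicit_equation P0 P1 Q \<phi> \<longleftrightarrow> vanishing_ideal P0 P1 Q = {f. \<phi> dvd f}"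

definition newton_polygon :: "complex poly poly \<Rightarrow> (real \<times> real) set" where
  "newton_polygon f = convex hull {(real a, real b) | a b. coeff (coeff f b) a \<noteq> 0}"

definition vertices :: "(real \<times> real) set \<Rightarrow> (real \<times> real) set" where
  "vertices S = {v. v extreme_point_of S}"

text \<open>The coordinates \<open>e\<^sub>0, e\<^sub>1, e\<^sub>2\<close> of the exponent of the homogeneous equation of
  degree \<open>u\<close> corresponding to the exponent \<open>p = (e\<^sub>0, e\<^sub>1)\<close> of the affine one.\<close>

definition hom_coord :: "nat \<Rightarrow> real \<times> real \<Rightarrow> nat \<Rightarrow> real" where
  "hom_coord u p l =
     (if l = 0 then fst p else if l = 1 then snd p else real u - fst p - snd p)"

definition coord_pair :: "nat \<Rightarrow> nat \<Rightarrow> nat \<Rightarrow> real \<times> real \<Rightarrow> real \<times> real" where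
  "coord_pair u i j p = (hom_coord u p i, hom_coord u p j)"

text \<open>The bound on \<open>bR A k\<close> is not strict.  If \<open>bL A 0\<close> and \<open>bL A 1\<close> are positive and
  \<open>bR A 0 = bR A 1 = max_deg A\<close> (for example \<open>B\<^sub>0 = B\<^sub>1 = [1, 2]\<close> and \<open>B\<^sub>2 = [0, 1]\<close>), no
  choice of indices satisfies \<open>bR A k < max_deg A\<close>.\<close>

definition admissible :: "(nat \<Rightarrow> nat set) \<Rightarrow> nat \<Rightarrow> nat \<Rightarrow> nat \<Rightarrow> bool" where
  "admissible A i j k \<longleftrightarrow> {i, j, k} = {0, 1, 2} \<and>
     0 < bL A i \<and> bL A i \<le> bR A i \<and> bR A i = max_deg A \<and>
     0 = bL A j \<and> bL A j \<le> bR A j \<and> bR A j < max_deg A \<and>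
     0 \<le> bL A k \<and> bL A k \<le> bR A k \<and> bR A k \<le> max_deg A"

end

theory Submission
  imports Defs "Jordan_Normal_Form.Char_Poly" "Subresultants.Subresultant_Gcd"
    "HOL-Computational_Algebra.Field_as_Ring"
begin

text \<open>
  Let \<open>P\<^sub>i\<close>, \<open>P\<^sub>j\<close>, \<open>P\<^sub>k\<close> be the three polynomials, with
  \<open>P\<^sub>i\<close> of degree \<open>u\<close> and vanishing to order \<open>a\<close> at \<open>0\<close>, \<open>P\<^sub>j\<close> of degree \<open>g < u\<close> and
  nonzero at \<open>0\<close>, and \<open>P\<^sub>k\<close> of degree \<open>h\<close> and of order \<open>b\<close> at \<open>0\<close>.  The genericity that is
  needed is that \<open>P\<^sub>0\<close> and \<open>P\<^sub>1\<close> have no common root other than \<open>0\<close>; it is an open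
  condition because a resultant depends continuously on the coefficients, and a dense one
  because all but finitely many changes of one coefficient of \<open>P\<^sub>0\<close> achieve it.  Together
  with the two coprimality hypotheses it says that any two of the three polynomials have
  at most the root \<open>0\<close> in common.  In tropical terms the curve then has one ray for each
  coordinate direction, one for the point \<open>t = 0\<close> and one for \<open>t = \<infinity>\<close>, so that its Newton
  polygon has at most five edges.  The proof computes the polygon directly.

  In the affine chart \<open>x = P\<^sub>i/P\<^sub>j\<close>, \<open>z = P\<^sub>k/P\<^sub>j\<close> the function \<open>z\<close> is integral over \<open>\<complex>[x]\<close>.
  A characteristic polynomial gives an equation \<open>\<psi>(x, z)\<close> of the curve, monic of degree \<open>u\<close>
  in \<open>z\<close>.  For almost all \<open>x\<close> the equation \<open>P\<^sub>i = x P\<^sub>j\<close> has \<open>u\<close> simple roots \<open>t\<close>, and as the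
  parameterization has degree one, these have \<open>u\<close> different values of \<open>z\<close>.  Two facts follow.
  Every equation of the curve of total degree at most \<open>u\<close> is a multiple of \<open>\<psi>\<close>
  (\<open>psi_unique\<close>), and up to a constant factor \<open>\<psi>(x, z)\<close> is the product of
  \<open>z P\<^sub>j(t) - P\<^sub>k(t)\<close> over the roots \<open>t\<close> of \<open>P\<^sub>i - x P\<^sub>j\<close> (\<open>psi_root_prod\<close>).

  The product formula yields inequalities for the exponents of \<open>\<psi>\<close>.  When \<open>x\<close> and \<open>z\<close> are
  scaled with powers of a parameter \<open>s\<close>, a bound on products of roots
  (\<open>prod_roots_le_coeff_norm\<close>) controls the growth of \<open>\<psi>\<close>, and growth controls the weights
  of the exponents (\<open>supp2_weight_le_growth\<close>).  A scaling that looks at \<open>t = 0\<close> gives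
  \<open>psi_weight_zero\<close>, and one that looks at \<open>t = \<infinity>\<close> gives \<open>psi_weight_infinity\<close>, which includes
  the bound \<open>u\<close> for the total degree.  In the other direction, exchanging the roles of
  the two polynomials in a product over roots (\<open>root_prod_swap\<close>) makes \<open>\<psi>\<close> explicit on the
  three sides of the triangle of exponents of degree \<open>u\<close>, which shows that the proposed
  vertices do belong to the Newton polygon (\<open>psi_corners_H\<close>, \<open>psi_corner_F\<close>, \<open>psi_corner_G\<close>).
  Every point that satisfies the inequalities lies in the convex hull of the proposed
  vertices (\<open>pentagon_in_hull\<close>), so the polygon of \<open>\<psi>\<close> is this hull.

  It remains to pass from the chart of \<open>\<psi>\<close> to that of \<open>\<phi>\<close>, by homogenizing to degree \<open>u\<close>.
  The transform of \<open>\<psi>\<close> is a multiple of \<open>\<phi>\<close>, which bounds the total degree of \<open>\<phi>\<close> by \<open>u\<close>;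
  the transform of \<open>\<phi>\<close> is then a constant multiple of \<open>\<psi>\<close> by \<open>psi_unique\<close>
  (\<open>implicit_equation_support\<close>).
\<close>

(* smult without qualifier is scalar multiplication of polynomials, not of modules *)
hide_const (open) module.smult

section \<open>Products over the roots of a polynomial\<close>

text \<open>Up to a power of the leading coefficient of \<open>f\<close> this is the resultant of \<open>f\<close> and \<open>g\<close>.  Roots
  are taken with their multiplicities.\<close>

definition root_prod :: "complex poly \<Rightarrow> complex poly \<Rightarrow> complex" where
  "root_prod f g = (\<Prod>t\<in>#proots f. poly g t)"

lemma poly_eq_prod_proots:
  fixes f :: "complex poly"
  shows "poly f x = lead_coeff f * (\<Prod>t\<in>#proots f. x - t)"
proof -
  have "poly f x = poly (smult (lead_coeff f) (\<Prod>t\<in>#proots f. [:-t, 1:])) x"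
    by (simp only: complex_poly_decompose_multiset)
  also have "\<dots> = lead_coeff f * (\<Prod>t\<in>#proots f. x - t)"
    by (simp add: poly_prod_mset image_mset.compositionality o_def)
  finally show ?thesis .
qed

text \<open>Both products are, up to leading coefficients and sign, the product of all differences
  of a root of \<open>f\<close> and a root of \<open>g\<close>.  This symmetry of the resultant is what makes a product
  over the roots of a polynomial that depends on a parameter explicit in that parameter.\<close>

lemma root_prod_swap:
  fixes f g :: "complex poly"
  shows "lead_coeff f ^ degree g * root_prod f g =
    (-1) ^ (degree f * degree g) * (lead_coeff g ^ degree f * root_prod g f)"
proof -
  define D where "D = (\<Prod>t\<in>#proots f. \<Prod>s\<in>#proots g. t - s)"
  have 1: "root_prod f g = lead_coeff g ^ degree f * D"
    unfolding root_prod_def D_def poly_eq_prod_proots[of g]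
    by (simp add: prod_mset.distrib size_proots_complex)
  have "root_prod g f = lead_coeff f ^ degree g * (\<Prod>s\<in>#proots g. \<Prod>t\<in>#proots f. s - t)"
    unfolding root_prod_def poly_eq_prod_proots[of f]
    by (simp add: prod_mset.distrib size_proots_complex)
  also have "(\<Prod>s\<in>#proots g. \<Prod>t\<in>#proots f. s - t) = (\<Prod>t\<in>#proots f. \<Prod>s\<in>#proots g. s - t)"
    by (rule prod_mset.swap)
  also have "\<dots> = (\<Prod>t\<in>#proots f. \<Prod>s\<in>#proots g. (-1) * (t - s))" by simp
  also have "\<dots> = (-1) ^ (degree f * degree g) * D"
    unfolding D_def prod_mset.distrib
    by (simp add: size_proots_complex flip: power_mult) (simp add: mult.commute)
  finally have 2: "root_prod g f = lead_coeff f ^ degree g * ((-1) ^ (degree f * degree g) * D)" .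
  show ?thesis unfolding 1 2 by (simp add: power_mult_distrib mult_ac flip: power_add mult_2)
qed

lemma root_prod_eq_0_iff:
  assumes "f \<noteq> 0"
  shows "root_prod f g = 0 \<longleftrightarrow> (\<exists>t. poly f t = 0 \<and> poly g t = 0)"
  using assms by (auto simp: root_prod_def)

lemma pencil_degree:
  fixes F G :: "complex poly"
  assumes "degree G < degree F"
  shows "degree (F - smult x G) = degree F" "lead_coeff (F - smult x G) = lead_coeff F"
    "F - smult x G \<noteq> 0"
proof -
  have *: "degree (smult x G) < degree F"
    using assms degree_smult_le[of x G] by linarith
  show "degree (F - smult x G) = degree F"
    using * by (metis degree_add_eq_left degree_minus diff_conv_add_uminus)
  moreover have "coeff (smult x G) (degree F) = 0" using * by (rule coeff_eq_0)
  ultimately show "lead_coeff (F - smult x G) = lead_coeff F" by simp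
  with assms show "F - smult x G \<noteq> 0" by (metis degree_0 leading_coeff_0_iff not_less_zero)
qed

text \<open>The roots of \<open>F - x G\<close> move with \<open>x\<close>, but after the swap the product runs over the fixed
  roots of \<open>g\<close>.  As the degree of \<open>G\<close> is smaller than that of \<open>F\<close>, degree and leading
  coefficient of the pencil do not depend on \<open>x\<close>, so the product is a polynomial in \<open>x\<close>.\<close>

lemma root_prod_pencil:
  fixes F G g :: "complex poly"
  assumes "degree G < degree F"
  shows "root_prod (F - smult x G) g =
    (-1) ^ (degree F * degree g) * lead_coeff g ^ degree F / lead_coeff F ^ degree g *
      poly (\<Prod>s\<in>#proots g. [:poly F s, - poly G s:]) x"
proof -
  have "lead_coeff F \<noteq> 0" "coeff G (degree F) = 0" using assms by (auto simp: coeff_eq_0)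
  moreover have "root_prod g (F - smult x G) = poly (\<Prod>s\<in>#proots g. [:poly F s, - poly G s:]) x"
    by (simp add: root_prod_def poly_prod_mset image_mset.compositionality o_def algebra_simps)
  ultimately show ?thesis
    using root_prod_swap[of "F - smult x G" g]
    unfolding pencil_degree(1,2)[OF assms] by (simp add: field_simps)
qed

text \<open>Reads off which powers bound a product of linear factors from above and from below.  The
  restrictions of the implicit equation to the coordinate axes are such products.\<close>

lemma prod_linear_factors:
  fixes \<alpha> \<beta> :: "'b \<Rightarrow> 'a :: idom"
  assumes "\<And>s. s \<in># M \<Longrightarrow> \<alpha> s \<noteq> 0 \<or> \<beta> s \<noteq> 0"
  shows "(\<Prod>s\<in>#M. [:\<alpha> s, \<beta> s:]) \<noteq> 0"
    and "degree (\<Prod>s\<in>#M. [:\<alpha> s, \<beta> s:]) = size (filter_mset (\<lambda>s. \<beta> s \<noteq> 0) M)"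
    and "order 0 (\<Prod>s\<in>#M. [:\<alpha> s, \<beta> s:]) = size (filter_mset (\<lambda>s. \<alpha> s = 0) M)"
proof -
  have "(\<Prod>s\<in>#M. [:\<alpha> s, \<beta> s:]) \<noteq> 0 \<and>
     degree (\<Prod>s\<in>#M. [:\<alpha> s, \<beta> s:]) = size (filter_mset (\<lambda>s. \<beta> s \<noteq> 0) M) \<and>
     order 0 (\<Prod>s\<in>#M. [:\<alpha> s, \<beta> s:]) = size (filter_mset (\<lambda>s. \<alpha> s = 0) M)"
    using assms
  proof (induction M)
    case empty
    then show ?case by (simp add: order_1_eq_0)
  next
    case (add s M)
    let ?P = "\<Prod>s\<in>#M. [:\<alpha> s, \<beta> s:]"
    have IH: "?P \<noteq> 0" "degree ?P = size (filter_mset (\<lambda>s. \<beta> s \<noteq> 0) M)"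
      "order 0 ?P = size (filter_mset (\<lambda>s. \<alpha> s = 0) M)"
      using add by auto
    have s: "\<alpha> s \<noteq> 0 \<or> \<beta> s \<noteq> 0" using add.prems by simp
    then have nz: "[:\<alpha> s, \<beta> s:] \<noteq> 0" by simp
    have "order 0 [:\<alpha> s, \<beta> s:] = (if \<alpha> s = 0 then 1 else 0)"
    proof (cases "\<alpha> s = 0")
      case True
      then have eq: "[:\<alpha> s, \<beta> s:] = [:-0, 1:] ^ 1 * [:\<beta> s:]" by simp
      have "order 0 ([:-0, 1:] ^ 1 * [:\<beta> s:]) = order 0 ([:-0, 1:] ^ 1 :: 'a poly) + order 0 [:\<beta> s:]"
        using s True by (intro order_mult) auto
      also have "\<dots> = 1" using s True by (subst order_power_n_n) (simp add: order_0I)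
      finally show ?thesis using True eq by simp
    next
      case False
      then show ?thesis by (simp add: order_0I)
    qed
    then show ?case
      using IH nz by (auto simp: order_mult degree_mult_eq simp del: mult_pCons_left)
  qed
  then show "(\<Prod>s\<in>#M. [:\<alpha> s, \<beta> s:]) \<noteq> 0"
    and "degree (\<Prod>s\<in>#M. [:\<alpha> s, \<beta> s:]) = size (filter_mset (\<lambda>s. \<beta> s \<noteq> 0) M)"
    and "order 0 (\<Prod>s\<in>#M. [:\<alpha> s, \<beta> s:]) = size (filter_mset (\<lambda>s. \<alpha> s = 0) M)"
    by auto
qed

lemma coeff_order_nonzero:
  fixes p :: "'a :: idom poly"
  assumes "p \<noteq> 0"
  shows "coeff p (order 0 p) \<noteq> 0"
proof -
  obtain q where q: "p = [:-0, 1:] ^ order 0 p * q" "\<not> [:-0, 1:] dvd q"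
    using order_decomp[OF assms, of 0] by auto
  have "coeff p (order 0 p) = coeff ([:0, 1:] ^ order 0 p * q) (order 0 p)" using q(1) by simp
  also have "\<dots> = coeff q 0"
    using coeff_monom_mult[of 1 "order 0 p" q "order 0 p"] by (simp add: monom_altdef)
  finally show ?thesis using q(2) poly_eq_0_iff_dvd[of q 0] by (simp add: poly_0_coeff_0)
qed

lemma coeff_below_order:
  fixes p :: "'a :: idom poly"
  assumes "m < order 0 p"
  shows "coeff p m = 0"
proof -
  have "monom 1 (order 0 p) dvd p"
    using order_1[of 0 p] by (simp add: monom_altdef)
  then obtain q where "p = monom 1 (order 0 p) * q" by (auto elim: dvdE)
  then have "coeff p m = coeff (monom 1 (order 0 p) * q) m" by simp
  with assms show ?thesis by (simp add: coeff_monom_mult)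
qed

lemma order_0_supp:
  fixes p :: "'a :: idom poly"
  assumes "coeff p n \<noteq> 0" "\<And>m. m < n \<Longrightarrow> coeff p m = 0"
  shows "order 0 p = n"
proof -
  have "p \<noteq> 0" using assms by auto
  then have "\<not> order 0 p < n" using coeff_order_nonzero assms(2) by blast
  moreover have "\<not> n < order 0 p" using coeff_below_order assms(1) by blast
  ultimately show ?thesis by simp
qed

lemma size_filter_eq_const:
  assumes "\<And>s. s \<in># M \<Longrightarrow> P s \<longleftrightarrow> s = c"
  shows "size (filter_mset P M) = count M c"
proof -
  have "filter_mset P M = filter_mset (\<lambda>s. s = c) M" using assms by (rule filter_mset_cong0)
  also have "\<dots> = replicate_mset (count M c) c" by (simp add: filter_eq_replicate_mset)
  finally show ?thesis by simp
qed

section \<open>Bounding the roots by the coefficients\<close>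

definition coeff_norm :: "real \<Rightarrow> complex poly \<Rightarrow> real" where
  "coeff_norm s f = (\<Sum>m\<le>degree f. norm (coeff f m) * s ^ m)"

lemma coeff_norm_nonneg: "s \<ge> 0 \<Longrightarrow> 0 \<le> coeff_norm s f"
  by (simp add: coeff_norm_def sum_nonneg)

text \<open>Division by a linear factor is stable in the weighted coefficient norm, with a gain of
  \<open>s + \<bar>\<alpha>\<bar>\<close>.  This is where the modulus of a root enters the estimates.\<close>

lemma coeff_norm_mult_linear:
  assumes s: "s > 0"
  shows "(s + norm \<alpha>) * coeff_norm s g \<le> 2 * real (Suc (degree g)) * coeff_norm s ([:-\<alpha>, 1:] * g)"
proof (cases "g = 0")
  case True
  then show ?thesis by (simp add: coeff_norm_def)
next
  case False
  define h where "h = [:-\<alpha>, 1:] * g"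
  define n where "n = degree g"
  have degh: "degree h = Suc n" using False unfolding h_def n_def by (subst degree_mult_eq) auto
  have h0: "coeff h 0 = - \<alpha> * coeff g 0" by (simp add: h_def)
  have hS: "coeff h (Suc m) = coeff g m - \<alpha> * coeff g (Suc m)" for m by (simp add: h_def)
  define B where "B m = norm (coeff h m) * s ^ m" for m
  have B0: "B m \<ge> 0" for m using s by (simp add: B_def)
  have N: "coeff_norm s h = sum B {..Suc n}" by (simp add: coeff_norm_def degh B_def)
  \<comment> \<open>The coefficients of \<open>g\<close> satisfy a recursion in both directions.  Run it downwards for a small root and upwards for a large one, so that errors are not amplified.\<close>
  have key: "max s (norm \<alpha>) * (norm (coeff g m) * s ^ m) \<le> coeff_norm s h" if m: "m \<le> n" for m
  proof (cases "norm \<alpha> \<le> s")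
    case True
    have "norm (coeff g m) * s ^ Suc m \<le> sum B {m<..Suc n}" if "m \<le> Suc n" for m
      using that
    proof (induction m rule: inc_induct)
      case base
      show ?case by (simp add: n_def coeff_eq_0)
    next
      case (step m)
      have "coeff g m = coeff h (Suc m) + \<alpha> * coeff g (Suc m)" by (simp add: hS)
      then have "norm (coeff g m) \<le> norm (coeff h (Suc m)) + norm \<alpha> * norm (coeff g (Suc m))"
        by (metis norm_mult norm_triangle_ineq)
      also have "\<dots> \<le> norm (coeff h (Suc m)) + s * norm (coeff g (Suc m))"
        using True by (simp add: mult_right_mono)
      finally have "norm (coeff g m) * s ^ Suc m \<le>
          (norm (coeff h (Suc m)) + s * norm (coeff g (Suc m))) * s ^ Suc m"
        using s by (intro mult_right_mono) auto
      also have "\<dots> = B (Suc m) + norm (coeff g (Suc m)) * s ^ Suc (Suc m)"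
        by (simp add: B_def algebra_simps)
      also have "\<dots> \<le> B (Suc m) + sum B {Suc m<..Suc n}" using step.IH by simp
      also have "\<dots> = sum B {m<..Suc n}"
      proof -
        have "{m<..Suc n} = insert (Suc m) {Suc m<..Suc n}" using step.hyps by auto
        then show ?thesis by simp
      qed
      finally show ?case .
    qed
    then have "norm (coeff g m) * s ^ Suc m \<le> sum B {m<..Suc n}" using m by simp
    also have "\<dots> \<le> coeff_norm s h" unfolding N by (intro sum_mono2) (auto simp: B0)
    finally show ?thesis using True by (simp add: max_def mult_ac)
  next
    case False
    have "norm \<alpha> * (norm (coeff g m) * s ^ m) \<le> sum B {..m}" for m
    proof (induction m)
      case 0
      show ?case by (simp add: B_def h0 norm_mult)
    next
      case (Suc m)
      have "\<alpha> * coeff g (Suc m) = coeff g m - coeff h (Suc m)" by (simp add: hS)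
      then have "norm \<alpha> * norm (coeff g (Suc m)) \<le> norm (coeff g m) + norm (coeff h (Suc m))"
        by (metis norm_mult norm_triangle_ineq4)
      then have "norm \<alpha> * norm (coeff g (Suc m)) * s ^ Suc m \<le>
          (norm (coeff g m) + norm (coeff h (Suc m))) * s ^ Suc m"
        using s by (intro mult_right_mono) auto
      also have "\<dots> = s * (norm (coeff g m) * s ^ m) + B (Suc m)" by (simp add: B_def algebra_simps)
      also have "\<dots> \<le> norm \<alpha> * (norm (coeff g m) * s ^ m) + B (Suc m)"
        using False s by (simp add: mult_right_mono)
      also have "\<dots> \<le> sum B {..Suc m}" using Suc by simp
      finally show ?case by (simp add: mult_ac)
    qed
    then have "norm \<alpha> * (norm (coeff g m) * s ^ m) \<le> sum B {..m}" .
    also have "\<dots> \<le> coeff_norm s h" unfolding N using m by (intro sum_mono2) (auto simp: B0)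
    finally show ?thesis using False by (simp add: max_def)
  qed
  have "max s (norm \<alpha>) * coeff_norm s g = (\<Sum>m\<le>n. max s (norm \<alpha>) * (norm (coeff g m) * s ^ m))"
    by (simp add: coeff_norm_def n_def sum_distrib_left)
  also have "\<dots> \<le> (\<Sum>m\<le>n. coeff_norm s h)" using key by (intro sum_mono) auto
  also have "\<dots> = real (Suc n) * coeff_norm s h" by simp
  finally have *: "max s (norm \<alpha>) * coeff_norm s g \<le> real (Suc n) * coeff_norm s h" .
  have "(s + norm \<alpha>) * coeff_norm s g \<le> (2 * max s (norm \<alpha>)) * coeff_norm s g"
    using s by (intro mult_right_mono coeff_norm_nonneg) auto
  also have "\<dots> \<le> 2 * (real (Suc n) * coeff_norm s h)" using * by linarith
  finally show ?thesis by (simp only: h_def n_def mult.assoc)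
qed

lemma prod_roots_le_coeff_norm_monic:
  assumes s: "s > 0"
  shows "(\<Prod>t\<in>#M. s + norm t) \<le>
    (2 * real (Suc (size M))) ^ size M * coeff_norm s (\<Prod>t\<in>#M. [:-t, 1:])"
proof (induction M)
  case empty
  then show ?case by (simp add: coeff_norm_def)
next
  case (add t M)
  define n where "n = size M"
  let ?g = "\<Prod>t\<in>#M. [:-t, 1:]"
  have dg: "degree ?g = n"
  proof -
    have "degree (\<Prod>t\<in>#M. [:-t, 1:]) = size M" for M :: "complex multiset"
    proof (induction M)
      case (add x M)
      have "(\<Prod>t\<in>#M. [:-t, 1:]) \<noteq> (0 :: complex poly)" by auto
      then have "degree ([:-x, 1:] * (\<Prod>t\<in>#M. [:-t, 1:])) = 1 + degree (\<Prod>t\<in>#M. [:-t, 1:])"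
        by (subst degree_mult_eq) auto
      then show ?case using add by (simp del: mult_pCons_left)
    qed simp
    then show ?thesis by (simp add: n_def)
  qed
  have "(\<Prod>t\<in>#add_mset t M. s + norm t) = (s + norm t) * (\<Prod>t\<in>#M. s + norm t)" by simp
  also have "\<dots> \<le> (s + norm t) * ((2 * real (Suc n)) ^ n * coeff_norm s ?g)"
    using add s by (intro mult_left_mono) (auto simp: n_def)
  also have "\<dots> = (2 * real (Suc n)) ^ n * ((s + norm t) * coeff_norm s ?g)" by simp
  also have "\<dots> \<le> (2 * real (Suc n)) ^ n * (2 * real (Suc n) * coeff_norm s ([:-t, 1:] * ?g))"
    using coeff_norm_mult_linear[OF s, of t ?g] unfolding dg by (intro mult_left_mono) auto
  also have "\<dots> = (2 * real (Suc n)) ^ Suc n * coeff_norm s ([:-t, 1:] * ?g)" by simp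
  also have "\<dots> \<le> (2 * real (Suc (Suc n))) ^ Suc n * coeff_norm s ([:-t, 1:] * ?g)"
    using s by (intro mult_right_mono power_mono coeff_norm_nonneg) auto
  finally show ?case by (simp add: n_def del: mult_pCons_left power_Suc)
qed

text \<open>A variant of the bound for the Mahler measure, at scale \<open>s\<close>: small coefficients force many
  roots to be small.  It replaces any analysis of the individual roots.\<close>

lemma prod_roots_le_coeff_norm:
  assumes s: "s > 0"
  shows "norm (lead_coeff f) * (\<Prod>t\<in>#proots f. s + norm t) \<le>
    (2 * real (Suc (degree f))) ^ degree f * coeff_norm s f"
proof (cases "f = 0")
  case False
  define p where "p = (\<Prod>t\<in>#proots f. [:-t, 1:])"
  define l where "l = lead_coeff f"
  have l: "l \<noteq> 0" using False by (simp add: l_def)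
  have f: "f = smult l p"
    unfolding p_def l_def by (rule complex_poly_decompose_multiset[symmetric])
  have "coeff_norm s f = norm l * coeff_norm s p"
    using l by (simp add: f coeff_norm_def norm_mult sum_distrib_left mult_ac)
  then show ?thesis
    using prod_roots_le_coeff_norm_monic[OF s, of "proots f"] l
    unfolding p_def[symmetric] l_def[symmetric] size_proots_complex by (simp add: mult_left_mono mult.left_commute)
qed (simp add: coeff_norm_def)

lemma prod_mset_mono:
  fixes \<alpha> \<beta> :: "'b \<Rightarrow> real"
  assumes "\<And>t. t \<in># M \<Longrightarrow> 0 \<le> \<alpha> t \<and> \<alpha> t \<le> \<beta> t"
  shows "(\<Prod>t\<in>#M. \<alpha> t) \<le> (\<Prod>t\<in>#M. \<beta> t)"
proof -
  have "0 \<le> (\<Prod>t\<in>#M. \<alpha> t) \<and> (\<Prod>t\<in>#M. \<alpha> t) \<le> (\<Prod>t\<in>#M. \<beta> t)"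
    using assms
  proof (induction M)
    case (add t M)
    then have "0 \<le> \<alpha> t" "\<alpha> t \<le> \<beta> t"
      "0 \<le> (\<Prod>t\<in>#M. \<alpha> t)" "(\<Prod>t\<in>#M. \<alpha> t) \<le> (\<Prod>t\<in>#M. \<beta> t)" by auto
    then show ?case by (auto intro!: mult_mono)
  qed simp
  then show ?thesis by simp
qed

section \<open>Polynomials in two variables and growth\<close>

text \<open>Exponent pairs are written in the order (inner variable, outer variable), whereas
  coefficients of a nested polynomial are accessed in the opposite order.\<close>

definition supp2 :: "complex poly poly \<Rightarrow> (nat \<times> nat) set" where
  "supp2 f = {(p, q). coeff (coeff f q) p \<noteq> 0}"

lemma supp2_subset: "supp2 f \<subseteq> (SIGMA q:{..degree f}. {..degree (coeff f q)})\<inverse>"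
  by (auto simp: supp2_def converse_unfold intro!: le_degree)

lemma finite_supp2 [simp]: "finite (supp2 f)"
  by (rule finite_subset[OF supp2_subset]) auto

lemma poly2_expand:
  assumes "finite S" "supp2 f \<subseteq> S"
  shows "poly2 f (x, z) = (\<Sum>(p, q)\<in>S. coeff (coeff f q) p * x ^ p * z ^ q)"
proof -
  let ?c = "\<lambda>q p. coeff (coeff f q) p * x ^ p * z ^ q"
  let ?T = "SIGMA q:{..degree f}. {..degree (coeff f q)}"
  have "poly2 f (x, z) = (\<Sum>q\<le>degree f. poly (coeff f q) x * z ^ q)"
    by (simp add: poly2_def poly_altdef[of f] poly_sum)
  also have "\<dots> = (\<Sum>q\<le>degree f. \<Sum>p\<le>degree (coeff f q). ?c q p)"
    by (simp add: poly_altdef[of "coeff f _"] sum_distrib_right)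
  also have "\<dots> = (\<Sum>(q, p)\<in>?T. ?c q p)" by (rule sum.Sigma) auto
  also have "\<dots> = (\<Sum>(p, q)\<in>?T\<inverse>. ?c q p)"
    by (rule sum.reindex_bij_witness[of _ "\<lambda>(p,q). (q,p)" "\<lambda>(p,q). (q,p)"]) auto
  also have "\<dots> = (\<Sum>(p, q)\<in>supp2 f. ?c q p)"
    by (rule sum.mono_neutral_right) (use supp2_subset in \<open>auto simp: supp2_def\<close>)
  also have "\<dots> = (\<Sum>(p, q)\<in>S. ?c q p)"
    by (rule sum.mono_neutral_left) (use assms in \<open>auto simp: supp2_def\<close>)
  finally show ?thesis .
qed

text \<open>A nonzero polynomial in two variables cannot vanish at all points whose coordinates avoid
  a finite set.\<close>

lemma poly2_nonzero_point:
  assumes "f \<noteq> 0" "finite A"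
  obtains x z where "x \<notin> A" "z \<notin> A" "poly2 f (x, z) \<noteq> 0"
proof -
  have "finite {r. poly f r = 0}" using assms poly_roots_finite by blast
  then have "finite ((\<lambda>z. [:z:]) -` {r. poly f r = 0})" by (rule finite_vimageI) (simp add: inj_def)
  then have "finite ({z. poly f [:z:] = 0} \<union> A)" using assms by (simp add: vimage_def)
  then obtain z where z: "poly f [:z:] \<noteq> 0" "z \<notin> A"
    using ex_new_if_finite[OF infinite_UNIV_char_0] by blast
  have "finite ({x. poly (poly f [:z:]) x = 0} \<union> A)" using assms z poly_roots_finite by blast
  then obtain x where x: "poly (poly f [:z:]) x \<noteq> 0" "x \<notin> A"
    using ex_new_if_finite[OF infinite_UNIV_char_0] by blast
  show thesis using x z by (intro that[of x z]) (auto simp: poly2_def)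
qed

text \<open>Along \<open>s \<mapsto> (X s\<^sup>v, Z s\<^sup>w)\<close> the monomials of maximal weight dominate as \<open>s\<close> tends to infinity,
  and for suitable \<open>X\<close> and \<open>Z\<close> they do not cancel.  So the order of growth for all \<open>X\<close> and \<open>Z\<close>
  is the maximal weight.  Only the exponent \<open>m\<close> has to be uniform, \<open>C\<close> may depend on \<open>X\<close> and \<open>Z\<close>.\<close>

lemma supp2_weight_le_growth:
  fixes f :: "complex poly poly" and v w m :: real
  assumes bound: "\<And>X Z. X \<noteq> 0 \<Longrightarrow> Z \<noteq> 0 \<Longrightarrow> \<exists>C. \<forall>s\<ge>1.
      norm (poly2 f (X * complex_of_real (s powr v), Z * complex_of_real (s powr w))) \<le> C * s powr m"
    and pq: "(p, q) \<in> supp2 f"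
  shows "v * real p + w * real q \<le> m"
proof -
  define wt where "wt = (\<lambda>(p, q). v * real p + w * real q)"
  define \<mu> where "\<mu> = Max (wt ` supp2 f)"
  have le: "wt e \<le> \<mu>" if "e \<in> supp2 f" for e using that by (simp add: \<mu>_def)
  have "\<mu> \<in> wt ` supp2 f" unfolding \<mu>_def using pq by (intro Max_in) auto
  then obtain p0 q0 where p0: "(p0, q0) \<in> supp2 f" "wt (p0, q0) = \<mu>" by auto
  define T where "T = {e \<in> supp2 f. wt e = \<mu>}"
  \<comment> \<open>the part of maximal weight\<close>
  define top where "top = (\<Sum>(p, q)\<in>T. monom (monom (coeff (coeff f q) p) p) q)"
  have finT: "finite T" by (simp add: T_def)
  have ctop: "coeff (coeff top q) p = (if (p, q) \<in> T then coeff (coeff f q) p else 0)" for p q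
  proof -
    have "coeff (coeff top q) p = (\<Sum>e\<in>T. if e = (p, q) then coeff (coeff f q) p else 0)"
      unfolding top_def by (simp add: coeff_sum case_prod_unfold, intro sum.cong) (auto simp: prod_eq_iff)
    then show ?thesis using finT by simp
  qed
  have "coeff (coeff top q0) p0 \<noteq> 0" using p0 by (simp add: ctop T_def supp2_def)
  then have "top \<noteq> 0" by auto
  then obtain X Z where XZ: "X \<noteq> 0" "Z \<noteq> 0" "poly2 top (X, Z) \<noteq> 0"
    using poly2_nonzero_point[of top "{0}"] by auto
  obtain C where C: "\<And>s. s \<ge> 1 \<Longrightarrow>
      norm (poly2 f (X * complex_of_real (s powr v), Z * complex_of_real (s powr w))) \<le> C * s powr m"
    using bound[OF XZ(1,2)] by blast
  define \<phi> where "\<phi> = (\<lambda>s. poly2 f (X * complex_of_real (s powr v), Z * complex_of_real (s powr w))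
      * complex_of_real (s powr (-\<mu>)))"
  define c where "c = (\<lambda>(p, q). coeff (coeff f q) p * X ^ p * Z ^ q)"
  have \<phi>: "\<phi> s = (\<Sum>e\<in>supp2 f. c e * complex_of_real (s powr (wt e - \<mu>)))" if "s \<ge> 1" for s
  proof -
    have "(s powr v) ^ p * (s powr w) ^ q * s powr (-\<mu>) = s powr (wt (p, q) - \<mu>)" for p q
      using that by (simp add: wt_def powr_power mult.commute flip: powr_add)
    then have *: "complex_of_real (s powr v) ^ p * complex_of_real (s powr w) ^ q * complex_of_real (s powr (-\<mu>))
        = complex_of_real (s powr (wt (p, q) - \<mu>))" for p q
      by (simp flip: of_real_power of_real_mult)
    have "(case e of (p, q) \<Rightarrow> coeff (coeff f q) p * (X * complex_of_real (s powr v)) ^ p *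
          (Z * complex_of_real (s powr w)) ^ q) * complex_of_real (s powr (-\<mu>))
        = c e * complex_of_real (s powr (wt e - \<mu>))" for e
    proof (cases e)
      case (Pair p q)
      show ?thesis unfolding Pair *[symmetric] by (simp add: c_def power_mult_distrib)
    qed
    then show ?thesis
      unfolding \<phi>_def poly2_expand[OF finite_supp2 order_refl] sum_distrib_right
      by (intro sum.cong refl)
  qed
  have "((\<lambda>s. \<Sum>e\<in>supp2 f. c e * complex_of_real (s powr (wt e - \<mu>))) \<longlongrightarrow>
      (\<Sum>e\<in>supp2 f. c e * (if e \<in> T then 1 else 0))) at_top"
  proof (intro tendsto_sum tendsto_mult tendsto_const)
    fix e assume e: "e \<in> supp2 f"
    show "((\<lambda>s. complex_of_real (s powr (wt e - \<mu>))) \<longlongrightarrow> (if e \<in> T then 1 else 0)) at_top"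
    proof (cases "e \<in> T")
      case True
      then have "\<forall>\<^sub>F s in at_top. complex_of_real (s powr (wt e - \<mu>)) = 1"
        by (intro eventually_mono[OF eventually_gt_at_top[of 0]]) (simp add: T_def)
      then show ?thesis using True by (simp add: tendsto_eventually)
    next
      case False
      then have "wt e - \<mu> < 0" using le[OF e] e by (auto simp: T_def)
      then have "((\<lambda>s. s powr (wt e - \<mu>)) \<longlongrightarrow> 0) at_top"
        by (intro tendsto_neg_powr filterlim_ident)
      from tendsto_of_real[OF this, where 'a = complex] False show ?thesis by simp
    qed
  qed
  also have "(\<Sum>e\<in>supp2 f. c e * (if e \<in> T then 1 else 0)) = (\<Sum>e\<in>T. c e)"
    by (rule sum.mono_neutral_cong_right) (auto simp: T_def)
  also have "\<dots> = poly2 top (X, Z)"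
  proof -
    have "supp2 top \<subseteq> T" by (auto simp: supp2_def ctop split: if_splits)
    from poly2_expand[OF finT this] show ?thesis
      by (simp add: c_def ctop case_prod_unfold)
  qed
  finally have "((\<lambda>s. \<Sum>e\<in>supp2 f. c e * complex_of_real (s powr (wt e - \<mu>))) \<longlongrightarrow> poly2 top (X, Z)) at_top" .
  then have lim: "(\<phi> \<longlongrightarrow> poly2 top (X, Z)) at_top"
    by (rule Lim_transform_eventually) (intro eventually_mono[OF eventually_ge_at_top[of 1]], simp add: \<phi>)
  show ?thesis
  proof (rule ccontr)
    assume "\<not> v * real p + w * real q \<le> m"
    then have \<mu>m: "m - \<mu> < 0" using le[OF pq] by (simp add: wt_def)
    have "norm (\<phi> s) \<le> C * s powr (m - \<mu>)" if "s \<ge> 1" for s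
    proof -
      have "norm (\<phi> s) \<le> (C * s powr m) * s powr (-\<mu>)"
        unfolding \<phi>_def norm_mult using C[OF that] by (simp add: mult_right_mono)
      also have "\<dots> = C * s powr (m - \<mu>)"
        by (simp add: powr_diff powr_minus_divide)
      finally show ?thesis .
    qed
    then have "\<forall>\<^sub>F s in at_top. norm (\<phi> s) \<le> C * s powr (m - \<mu>)"
      by (intro eventually_mono[OF eventually_ge_at_top[of 1]])
    moreover have "((\<lambda>s. C * s powr (m - \<mu>)) \<longlongrightarrow> 0) at_top"
      using tendsto_mult_left[OF tendsto_neg_powr[OF \<mu>m filterlim_ident], of C] by simp
    ultimately have "(\<phi> \<longlongrightarrow> 0) at_top" by (rule Lim_null_comparison)
    with lim XZ(3) show False
      using tendsto_unique trivial_limit_at_top_linorder by blast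
  qed
qed

section \<open>An equation that is monic in one coordinate\<close>

lemma poly2_eq_poly_map: "poly2 f (x, z) = poly (map_poly (\<lambda>p. poly p x) f) z"
  by (induction f) (auto simp: poly2_def map_poly_pCons)

text \<open>Membership in the \<open>\<complex>[x]\<close>-span of \<open>1, t, \<dots>, t\<^sup>n\<^sup>-\<^sup>1\<close>, where \<open>x = F/G\<close> and \<open>n\<close> is the degree of \<open>F\<close>.
  Functions of \<open>t\<close> are compared away from the zeros of \<open>G\<close>.\<close>

definition low_span :: "complex poly \<Rightarrow> complex poly \<Rightarrow> (complex \<Rightarrow> complex) \<Rightarrow> bool" where
  "low_span F G \<phi> \<longleftrightarrow> (\<exists>a :: nat \<Rightarrow> complex poly. \<forall>t. poly G t \<noteq> 0 \<longrightarrow>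
     \<phi> t = (\<Sum>m<degree F. poly (a m) (poly F t / poly G t) * t ^ m))"

lemma low_span_cong:
  "low_span F G \<psi> \<Longrightarrow> (\<And>t. poly G t \<noteq> 0 \<Longrightarrow> \<phi> t = \<psi> t) \<Longrightarrow> low_span F G \<phi>"
  unfolding low_span_def by simp

lemma low_span_add: "low_span F G \<phi> \<Longrightarrow> low_span F G \<psi> \<Longrightarrow> low_span F G (\<lambda>t. \<phi> t + \<psi> t)"
proof -
  assume "low_span F G \<phi>" "low_span F G \<psi>"
  then obtain a b where ab: "\<And>t. poly G t \<noteq> 0 \<Longrightarrow> \<phi> t = (\<Sum>m<degree F. poly (a m) (poly F t / poly G t) * t ^ m)"
    "\<And>t. poly G t \<noteq> 0 \<Longrightarrow> \<psi> t = (\<Sum>m<degree F. poly (b m) (poly F t / poly G t) * t ^ m)"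
    unfolding low_span_def by blast
  show ?thesis unfolding low_span_def
    by (rule exI[of _ "\<lambda>m. a m + b m"]) (simp add: ab ring_distribs sum.distrib)
qed

lemma low_span_mult_x:
  assumes "low_span F G \<phi>"
  shows "low_span F G (\<lambda>t. poly r (poly F t / poly G t) * \<phi> t)"
proof -
  obtain a where a: "\<And>t. poly G t \<noteq> 0 \<Longrightarrow> \<phi> t = (\<Sum>m<degree F. poly (a m) (poly F t / poly G t) * t ^ m)"
    using assms unfolding low_span_def by blast
  show ?thesis unfolding low_span_def
    by (rule exI[of _ "\<lambda>m. r * a m"]) (simp add: a sum_distrib_left mult.assoc)
qed

lemma low_span_scale: "low_span F G \<phi> \<Longrightarrow> low_span F G (\<lambda>t. c * \<phi> t)"
  using low_span_mult_x[of F G \<phi> "[:c:]"] by simp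

text \<open>Solve \<open>F(t) - x G(t) = 0\<close> for the highest power of \<open>t\<close>.\<close>

lemma low_span_top_power:
  assumes "degree G < degree F"
  shows "low_span F G (\<lambda>t. t ^ degree F)"
proof -
  define l where "l = lead_coeff F"
  define u where "u = degree F"
  have l: "l \<noteq> 0" using assms by (auto simp: l_def)
  show ?thesis unfolding low_span_def
  proof (intro exI[of _ "\<lambda>m. [:- coeff F m / l, coeff G m / l:]"] allI impI)
    fix t assume G: "poly G t \<noteq> 0"
    define x where "x = poly F t / poly G t"
    have "{..u} = insert u {..<u}" by auto
    then have F: "poly F t = l * t ^ u + (\<Sum>m<u. coeff F m * t ^ m)"
      by (simp add: poly_altdef u_def l_def)
    have "poly G t = (\<Sum>m\<le>degree G. coeff G m * t ^ m)" by (simp add: poly_altdef)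
    also have "\<dots> = (\<Sum>m<u. coeff G m * t ^ m)"
      by (rule sum.mono_neutral_left) (use assms in \<open>auto simp: u_def coeff_eq_0\<close>)
    finally have "poly F t = x * (\<Sum>m<u. coeff G m * t ^ m)" using G by (simp add: x_def)
    then have "l * t ^ u = x * (\<Sum>m<u. coeff G m * t ^ m) - (\<Sum>m<u. coeff F m * t ^ m)"
      unfolding F by (simp add: eq_diff_eq)
    also have "\<dots> = (\<Sum>m<u. (x * coeff G m - coeff F m) * t ^ m)"
      by (simp add: sum_distrib_left left_diff_distrib sum_subtractf mult.assoc)
    also have "\<dots> = l * (\<Sum>m<u. poly [:- coeff F m / l, coeff G m / l:] x * t ^ m)"
    proof -
      have "poly [:- coeff F m / l, coeff G m / l:] x = (x * coeff G m - coeff F m) / l" for m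
        by (simp add: diff_divide_distrib)
      then show ?thesis using l by (simp add: sum_distrib_left del: poly_pCons)
    qed
    finally have "t ^ u = (\<Sum>m<u. poly [:- coeff F m / l, coeff G m / l:] x * t ^ m)"
      by (rule mult_left_cancel[OF l, THEN iffD1])
    then show "t ^ degree F = (\<Sum>m<degree F. poly [:- coeff F m / l, coeff G m / l:] (poly F t / poly G t) * t ^ m)"
      unfolding u_def x_def .
  qed
qed

lemma low_span_mult_t:
  assumes dg: "degree G < degree F" and "low_span F G \<phi>"
  shows "low_span F G (\<lambda>t. t * \<phi> t)"
proof -
  obtain n where n: "degree F = Suc n" using dg by (cases "degree F") auto
  obtain a where a: "\<And>t. poly G t \<noteq> 0 \<Longrightarrow> \<phi> t = (\<Sum>m<degree F. poly (a m) (poly F t / poly G t) * t ^ m)"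
    using assms(2) unfolding low_span_def by blast
  have 1: "low_span F G (\<lambda>t. \<Sum>m<n. poly (a m) (poly F t / poly G t) * t ^ Suc m)"
    unfolding low_span_def
    by (rule exI[of _ "\<lambda>m. if m = 0 then 0 else a (m - 1)"]) (simp add: n sum.lessThan_Suc_shift del: sum.lessThan_Suc)
  have 2: "low_span F G (\<lambda>t. poly (a n) (poly F t / poly G t) * t ^ degree F)"
    by (rule low_span_mult_x[OF low_span_top_power[OF dg]])
  have "low_span F G (\<lambda>t. (\<Sum>m<n. poly (a m) (poly F t / poly G t) * t ^ Suc m)
      + poly (a n) (poly F t / poly G t) * t ^ degree F)"
    by (rule low_span_add[OF 1 2])
  moreover have "t * \<phi> t = (\<Sum>m<n. poly (a m) (poly F t / poly G t) * t ^ Suc m)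
      + poly (a n) (poly F t / poly G t) * t ^ degree F" if "poly G t \<noteq> 0" for t
    by (simp add: a[OF that] n algebra_simps sum_distrib_left)
  ultimately show ?thesis by (rule low_span_cong)
qed

lemma low_span_mult_poly:
  assumes dg: "degree G < degree F" and "low_span F G \<phi>"
  shows "low_span F G (\<lambda>t. poly p t * \<phi> t)"
proof (induction p)
  case 0
  show ?case using low_span_scale[OF assms(2), of 0] by simp
next
  case (pCons c p)
  have "low_span F G (\<lambda>t. c * \<phi> t + t * (poly p t * \<phi> t))"
    by (rule low_span_add[OF low_span_scale[OF assms(2)] low_span_mult_t[OF dg pCons.IH]])
  then show ?case by (simp add: algebra_simps)
qed

lemma low_span_one:
  assumes "degree F > 0"
  shows "low_span F G (\<lambda>t. 1)"
proof -
  obtain n where n: "degree F = Suc n" using assms by (cases "degree F") auto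
  show ?thesis unfolding low_span_def
    by (rule exI[of _ "\<lambda>m. if m = 0 then 1 else 0"]) (simp add: n sum.lessThan_Suc_shift del: sum.lessThan_Suc)
qed

text \<open>If \<open>S F + T G = 1\<close>, then \<open>(S x + T) G = 1\<close>, so that the inverse of \<open>G\<close> is a polynomial in \<open>t\<close>
  and \<open>x\<close>.\<close>

lemma low_span_quotient:
  assumes dg: "degree G < degree F" and co: "coprime F G"
  shows "low_span F G (\<lambda>t. poly p t / poly G t)"
proof -
  obtain S T where ST: "S * F + T * G = 1"
    using bezout_coefficients_fst_snd[of F G] co by (auto simp: coprime_iff_gcd_eq_1)
  have "low_span F G (\<lambda>t. poly [:0,1:] (poly F t / poly G t) * (poly (p * S) t * 1) + poly (p * T) t * 1)"
    using dg by (auto intro!: low_span_add low_span_mult_x low_span_mult_poly low_span_one simp del: poly_pCons poly_mult mult_1_right)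
  moreover have "poly p t / poly G t =
      poly [:0,1:] (poly F t / poly G t) * (poly (p * S) t * 1) + poly (p * T) t * 1"
    if "poly G t \<noteq> 0" for t
  proof -
    have "poly S t * poly F t + poly T t * poly G t = 1"
      by (metis ST poly_add poly_mult poly_1)
    then have "poly p t = poly p t * (poly S t * poly F t + poly T t * poly G t)" by simp
    then show ?thesis using that by (simp add: field_simps)
  qed
  ultimately show ?thesis by (rule low_span_cong)
qed

text \<open>Multiplication by \<open>z = H/G\<close> maps the span of \<open>1, t, \<dots>, t\<^sup>n\<^sup>-\<^sup>1\<close> over \<open>\<complex>[x]\<close> into itself.  Write it
  as a matrix \<open>M\<close> over \<open>\<complex>[x]\<close>.  At each parameter \<open>t\<close> the vector of powers of \<open>t\<close> is an
  eigenvector of \<open>M(x)\<close> for the eigenvalue \<open>z\<close>, so the characteristic polynomial of \<open>M\<close> is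
  an equation of the curve.\<close>

theorem implicit_equation_monic:
  fixes F G H :: "complex poly"
  assumes dg: "degree G < degree F" and co: "coprime F G"
  obtains \<psi> :: "complex poly poly" where "degree \<psi> = degree F" "lead_coeff \<psi> = 1"
    "\<And>t. poly G t \<noteq> 0 \<Longrightarrow> poly2 \<psi> (poly F t / poly G t, poly H t / poly G t) = 0"
proof -
  define u where "u = degree F"
  have u: "u > 0" using dg by (simp add: u_def)
  have "\<forall>m. \<exists>a :: nat \<Rightarrow> complex poly. \<forall>t. poly G t \<noteq> 0 \<longrightarrow>
      poly (H * monom 1 m) t / poly G t = (\<Sum>n<u. poly (a n) (poly F t / poly G t) * t ^ n)"
    using low_span_quotient[OF dg co] unfolding low_span_def u_def by blast
  then obtain a :: "nat \<Rightarrow> nat \<Rightarrow> complex poly" where a: "\<And>m t. poly G t \<noteq> 0 \<Longrightarrow>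
      poly (H * monom 1 m) t / poly G t = (\<Sum>n<u. poly (a m n) (poly F t / poly G t) * t ^ n)"
    by metis
  define M where "M = mat u u (\<lambda>(m, n). a m n)"
  have M: "M \<in> carrier_mat u u" by (simp add: M_def)
  show thesis
  proof (rule that[of "char_poly M"])
    show "degree (char_poly M) = degree F" "lead_coeff (char_poly M) = 1"
      using degree_monic_char_poly[OF M] by (simp_all add: u_def)
    fix t assume G: "poly G t \<noteq> 0"
    define x where "x = poly F t / poly G t"
    define z where "z = poly H t / poly G t"
    have ev: "comm_ring_hom (\<lambda>p. poly p x)" by standard auto
    define M' where "M' = map_mat (\<lambda>p. poly p x) M"
    define v where "v = vec u (\<lambda>m. t ^ m)"
    have M': "M' \<in> carrier_mat u u" using M by (simp add: M'_def)
    have "M' *\<^sub>v v = z \<cdot>\<^sub>v v"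
    proof (rule eq_vecI)
      fix m assume "m < dim_vec (z \<cdot>\<^sub>v v)"
      then have m: "m < u" by (simp add: v_def)
      have "(M' *\<^sub>v v) $ m = (\<Sum>n<u. poly (a m n) x * t ^ n)"
        using m by (simp add: M'_def M_def v_def scalar_prod_def lessThan_atLeast0)
      also have "\<dots> = z * t ^ m" using a[OF G, of m] by (simp add: x_def z_def poly_monom)
      finally show "(M' *\<^sub>v v) $ m = (z \<cdot>\<^sub>v v) $ m" using m by (simp add: v_def)
    qed (use M' in \<open>simp add: v_def\<close>)
    moreover have "v \<noteq> 0\<^sub>v u"
    proof
      assume "v = 0\<^sub>v u"
      then have "v $ 0 = 0" using u by simp
      then show False using u by (simp add: v_def)
    qed
    ultimately have "eigenvalue M' z"
      unfolding eigenvalue_def eigenvector_def using M' by (auto intro!: exI[of _ v] simp: v_def)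
    then have "poly (char_poly M') z = 0" using eigenvalue_root_char_poly[OF M'] by simp
    moreover have "char_poly M' = map_poly (\<lambda>p. poly p x) (char_poly M)"
      unfolding M'_def by (rule comm_ring_hom.char_poly_hom[OF ev M])
    ultimately show "poly2 (char_poly M) (poly F t / poly G t, poly H t / poly G t) = 0"
      by (simp add: poly2_eq_poly_map x_def z_def)
  qed
qed

section \<open>The pencil of polynomials that defines the first coordinate\<close>

lemma no_common_root_imp_coprime:
  fixes f g :: "complex poly"
  assumes "f \<noteq> 0" "\<And>t. poly f t = 0 \<Longrightarrow> poly g t \<noteq> 0"
  shows "coprime f g"
proof (rule coprimeI)
  fix d assume d: "d dvd f" "d dvd g"
  have "\<not> (\<exists>t. poly d t = 0)" using d assms(2) by (metis dvdE mult_zero_left poly_mult)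
  then have "constant (poly d)" using fundamental_theorem_of_algebra by blast
  then have "degree d = 0" by (simp add: constant_degree)
  moreover have "d \<noteq> 0" using d assms(1) by auto
  ultimately show "is_unit d" by (simp add: is_unit_iff_degree)
qed

lemma poly_eqI_cofinite:
  fixes p q :: "complex poly"
  assumes "finite B" "\<And>x. x \<notin> B \<Longrightarrow> poly p x = poly q x"
  shows "p = q"
proof (rule ccontr)
  assume "p \<noteq> q"
  then have "finite {x. poly (p - q) x = 0}" by (intro poly_roots_finite) simp
  then have "finite (B \<union> {x. poly (p - q) x = 0})" using assms by simp
  moreover have "B \<union> {x. poly (p - q) x = 0} = UNIV" using assms by auto
  ultimately show False using infinite_UNIV_char_0 by metis
qed

text \<open>A polynomial with as many known zeros as its degree allows is determined by them and by
  one coefficient, also when that coefficient is zero.\<close>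

lemma poly_eq_smult_prodI:
  fixes p :: "complex poly"
  assumes deg: "degree p \<le> n" and card: "card S = n" "finite S"
    and roots: "\<And>s. s \<in> S \<Longrightarrow> poly p s = 0"
  shows "poly p z = coeff p n * (\<Prod>s\<in>S. z - s)"
proof -
  define P where "P = (\<Prod>s\<in>S. [:-s, 1:])"
  have degP: "degree P = n" unfolding P_def using card by (subst degree_prod_sum_eq) auto
  have lcP: "lead_coeff P = 1" unfolding P_def by (simp add: lead_coeff_prod)
  define D where "D = p - smult (coeff p n) P"
  have "D = 0"
  proof (rule ccontr)
    assume "D \<noteq> 0"
    have "degree D \<le> n" unfolding D_def using deg degP
      by (intro degree_diff_le) (auto intro: order.trans[OF degree_smult_le])
    moreover have "coeff D n = 0" using degP lcP by (simp add: D_def)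
    ultimately have "degree D < n"
      using \<open>D \<noteq> 0\<close> by (metis leading_coeff_0_iff le_neq_implies_less)
    have "S \<subseteq> {s. poly D s = 0}"
      using roots card by (auto simp: D_def P_def poly_prod)
    then have "n \<le> card {s. poly D s = 0}"
      using card poly_roots_finite[OF \<open>D \<noteq> 0\<close>] card_mono by blast
    also have "\<dots> \<le> degree D" by (rule card_poly_roots_bound[OF \<open>D \<noteq> 0\<close>])
    finally show False using \<open>degree D < n\<close> by simp
  qed
  then have "p = smult (coeff p n) P" by (simp add: D_def)
  then have "poly p z = poly (smult (coeff p n) P) z" by simp
  then show ?thesis by (simp add: P_def poly_prod)
qed

text \<open>\<open>F\<close>, \<open>G\<close>, \<open>H\<close> are the polynomials with the indices \<open>i\<close>, \<open>j\<close>, \<open>k\<close> of an admissible choice.  The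
  last assumption expresses degree one of the parameterization in the chart \<open>x = F/G\<close>,
  \<open>z = H/G\<close>; the exceptional set \<open>E\<close> is needed because the parameterization is only generically
  injective.\<close>

locale pencil =
  fixes F G H :: "complex poly" and u g h a b :: nat and E :: "complex set"
  assumes degF: "degree F = u" and degG: "degree G = g" and degH: "degree H = h"
    and gu: "g < u" and hu: "h \<le> u" and H0: "H \<noteq> 0"
    and ordF: "order 0 F = a" and ordH: "order 0 H = b" and a0: "0 < a"
    and FG: "\<And>t. poly G t = 0 \<Longrightarrow> poly F t \<noteq> 0"
    and GH: "\<And>t. poly G t = 0 \<Longrightarrow> poly H t \<noteq> 0"
    and FH: "\<And>t. poly F t = 0 \<Longrightarrow> poly H t = 0 \<Longrightarrow> t = 0"
    and finE: "finite E"
    and generic_inj: "\<And>s t. poly G s \<noteq> 0 \<Longrightarrow> poly G t \<noteq> 0 \<Longrightarrow> t \<notin> E \<Longrightarrow>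
        poly F s / poly G s = poly F t / poly G t \<Longrightarrow>
        poly H s / poly G s = poly H t / poly G t \<Longrightarrow> s = t"
begin

lemma F0: "F \<noteq> 0"
  using degF gu by auto

lemma poly_F_0: "poly F 0 = 0"
  using ordF a0 order_0I by fastforce

lemma poly_G_0: "poly G 0 \<noteq> 0"
  using poly_F_0 FG by blast

lemma G0: "G \<noteq> 0"
  using poly_G_0 by auto

lemma coprime_FG: "coprime F G"
  using no_common_root_imp_coprime[OF F0, of G] FG by blast

text \<open>The roots of this polynomial are the parameters of the points of the curve over \<open>x\<close>.\<close>

definition pen :: "complex \<Rightarrow> complex poly" where
  "pen x = F - smult x G"

lemma pen: "degree (pen x) = u" "lead_coeff (pen x) = lead_coeff F" "pen x \<noteq> 0"
  using pencil_degree[of G F x] gu unfolding pen_def degF degG by auto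

lemma size_proots_pen: "size (proots (pen x)) = u"
  by (simp add: size_proots_complex pen)

lemma pen_root:
  assumes "poly (pen x) t = 0"
  shows "poly G t \<noteq> 0" "poly F t = x * poly G t" "x = poly F t / poly G t"
proof -
  show 1: "poly F t = x * poly G t" using assms by (simp add: pen_def)
  show "poly G t \<noteq> 0" using FG[of t] 1 by auto
  then show "x = poly F t / poly G t" using 1 by simp
qed

text \<open>A multiple root of \<open>F - x G\<close> is a zero of the numerator of the derivative of \<open>F/G\<close>.  That
  numerator is not zero, since \<open>F\<close> would divide its own derivative otherwise.\<close>

lemma generic_simple_roots:
  obtains X where "finite X" "\<And>x. x \<notin> X \<Longrightarrow> proots (pen x) = mset_set {t. poly (pen x) t = 0}"
proof -
  \<comment> \<open>the numerator of the derivative of \<open>F/G\<close>\<close>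
  define W where "W = pderiv F * G - F * pderiv G"
  have "W \<noteq> 0"
  proof
    assume "W = 0"
    then have "F dvd pderiv F * G" by (auto simp: W_def)
    then have "F dvd pderiv F" using coprime_FG by (simp add: coprime_dvd_mult_left_iff)
    moreover have "pderiv F \<noteq> 0" using degF gu by (simp add: pderiv_eq_0_iff)
    ultimately have "degree F \<le> degree (pderiv F)" by (rule dvd_imp_degree_le)
    then show False using degF gu by (simp add: degree_pderiv)
  qed
  then have "finite {t. poly W t = 0}" by (rule poly_roots_finite)
  then have fin: "finite ((\<lambda>t. poly F t / poly G t) ` {t. poly W t = 0})" by simp
  show thesis
  proof (rule that[OF fin])
    fix x assume x: "x \<notin> (\<lambda>t. poly F t / poly G t) ` {t. poly W t = 0}"
    have "order t (pen x) = 1" if t: "poly (pen x) t = 0" for t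
    proof -
      have "poly W t \<noteq> 0" using x pen_root(3)[OF t] by auto
      then have nz: "poly (pderiv (pen x)) t \<noteq> 0"
        using pen_root(2)[OF t] by (auto simp: W_def pen_def pderiv_diff pderiv_smult algebra_simps)
      have "order t (pen x) = Suc (order t (pderiv (pen x)))"
        using nz t pen by (intro order_pderiv) (auto simp: order_root)
      with nz show ?thesis by (simp add: order_0I)
    qed
    then show "proots (pen x) = mset_set {t. poly (pen x) t = 0}"
      using pen(3)[of x] poly_roots_finite[OF pen(3)]
      by (intro multiset_eqI) (auto simp: count_mset_set' order_0I)
  qed
qed

text \<open>Over a generic \<open>x\<close> lie \<open>u\<close> points of the curve, and their coordinates \<open>z\<close> are distinct.  Any
  equation of the curve vanishes at them, which determines it up to a factor that depends
  on \<open>x\<close> if its degree in \<open>z\<close> is at most \<open>u\<close>.\<close>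

lemma generic_factorization:
  assumes deg: "degree f \<le> u" and fin: "finite B"
    and vanish: "\<And>t. t \<notin> B \<Longrightarrow> poly G t \<noteq> 0 \<Longrightarrow>
      poly2 f (poly F t / poly G t, poly H t / poly G t) = 0"
  shows "\<exists>X. finite X \<and> (\<forall>x z. x \<notin> X \<longrightarrow>
     poly2 f (x, z) = poly (coeff f u) x * (\<Prod>t\<in>#proots (pen x). z - poly H t / poly G t))"
proof -
  obtain X where X: "finite X"
    "\<And>x. x \<notin> X \<Longrightarrow> proots (pen x) = mset_set {t. poly (pen x) t = 0}"
    using generic_simple_roots by blast
  \<comment> \<open>all \<open>x\<close> with a multiple root, with an exceptional parameter, or where \<open>f\<close> need not vanish\<close>
  define Y where "Y = X \<union> (\<lambda>t. poly F t / poly G t) ` (E \<union> B)"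
  show ?thesis
  proof (intro exI[of _ Y] conjI allI impI)
    show "finite Y" using X finE fin by (simp add: Y_def)
    fix x z assume x: "x \<notin> Y"
    define R where "R = {t. poly (pen x) t = 0}"
    define \<zeta> where "\<zeta> = (\<lambda>t. poly H t / poly G t)"
    have R: "proots (pen x) = mset_set R" using X x by (simp add: Y_def R_def)
    have finR: "finite R" unfolding R_def using pen(3) by (rule poly_roots_finite)
    have cardR: "card R = u" using size_proots_pen[of x] by (simp add: R)
    have RD: "poly G t \<noteq> 0" "x = poly F t / poly G t" "t \<notin> E" "t \<notin> B" if "t \<in> R" for t
    proof -
      have root: "poly (pen x) t = 0" using that by (simp add: R_def)
      show "poly G t \<noteq> 0" and xt: "x = poly F t / poly G t" using pen_root[OF root] by blast+
      show "t \<notin> E" "t \<notin> B" using x xt unfolding Y_def by blast+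
    qed
    have inj: "inj_on \<zeta> R"
    proof (rule inj_onI)
      fix s t assume st: "s \<in> R" "t \<in> R" "\<zeta> s = \<zeta> t"
      show "s = t"
        by (rule generic_inj[OF RD(1)[OF st(1)] RD(1)[OF st(2)] RD(3)[OF st(2)]])
          (use st RD(2) in \<open>auto simp: \<zeta>_def\<close>)
    qed
    define p where "p = map_poly (\<lambda>q. poly q x) f"
    have cp: "coeff p n = poly (coeff f n) x" for n by (simp add: p_def coeff_map_poly)
    have "poly p z = coeff p u * (\<Prod>s\<in>\<zeta> ` R. z - s)"
    proof (rule poly_eq_smult_prodI)
      show "degree p \<le> u" using deg map_poly_degree_leq order.trans unfolding p_def by blast
      show "card (\<zeta> ` R) = u" "finite (\<zeta> ` R)" using inj finR cardR by (auto simp: card_image)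
      show "poly p s = 0" if s: "s \<in> \<zeta> ` R" for s
      proof -
        obtain t where t: "t \<in> R" "s = \<zeta> t" using s by blast
        from vanish[OF RD(4)[OF t(1)] RD(1)[OF t(1)]] have "poly2 f (x, \<zeta> t) = 0"
          unfolding RD(2)[OF t(1), symmetric] \<zeta>_def .
        then show ?thesis by (simp add: p_def poly2_eq_poly_map t(2))
      qed
    qed
    also have "(\<Prod>s\<in>\<zeta> ` R. z - s) = (\<Prod>t\<in>R. z - \<zeta> t)"
      by (rule prod.reindex_cong[OF inj]) auto
    also have "\<dots> = (\<Prod>t\<in>#proots (pen x). z - \<zeta> t)"
      unfolding R by (rule prod_unfold_prod_mset)
    finally show "poly2 f (x, z) = poly (coeff f u) x * (\<Prod>t\<in>#proots (pen x). z - poly H t / poly G t)"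
      by (simp add: poly2_eq_poly_map p_def[symmetric] cp \<zeta>_def)
  qed
qed

lemma root_prod_pen:
  "root_prod (pen x) r = (-1) ^ (u * degree r) * lead_coeff r ^ u / lead_coeff F ^ degree r *
      poly (\<Prod>s\<in>#proots r. [:poly F s, - poly G s:]) x"
  unfolding pen_def using root_prod_pencil[of G F x r] gu by (simp add: degF degG)

text \<open>The product of \<open>G(t)\<close> over the roots \<open>t\<close> of \<open>F - x G\<close>.  It has the same value for each \<open>x\<close>: after
  the swap it is a product of values \<open>F(s) - x G(s)\<close> with \<open>G(s) = 0\<close>.  Hence clearing the
  denominators \<open>G(t)\<close> of the coordinates \<open>z\<close> costs a nonzero constant only.\<close>

definition resG :: complex where
  "resG = root_prod (pen 0) G"

lemma root_prod_pen_G: "root_prod (pen x) G = resG" "resG \<noteq> 0"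
proof -
  have *: "poly (\<Prod>s\<in>#proots G. [:poly F s, - poly G s:]) x = (\<Prod>s\<in>#proots G. poly F s)" for x
  proof -
    have "(\<Prod>s\<in>#proots G. poly [:poly F s, - poly G s:] x) = (\<Prod>s\<in>#proots G. poly F s)"
      using G0 by (intro arg_cong[where f = prod_mset] image_mset_cong) auto
    then show ?thesis by (simp add: poly_prod_mset image_mset.compositionality o_def del: poly_pCons)
  qed
  show "root_prod (pen x) G = resG" by (simp only: resG_def root_prod_pen *)
  show "resG \<noteq> 0" unfolding resG_def using root_prod_eq_0_iff[OF pen(3)] pen_root(1) by blast
qed

definition psi :: "complex poly poly" where
  "psi = (SOME \<psi>. degree \<psi> = u \<and> lead_coeff \<psi> = 1 \<and>
     (\<forall>t. poly G t \<noteq> 0 \<longrightarrow> poly2 \<psi> (poly F t / poly G t, poly H t / poly G t) = 0))"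

lemma psi: "degree psi = u" "coeff psi u = 1"
    "poly G t \<noteq> 0 \<Longrightarrow> poly2 psi (poly F t / poly G t, poly H t / poly G t) = 0"
proof -
  have "\<exists>\<psi>. degree \<psi> = u \<and> lead_coeff \<psi> = 1 \<and>
     (\<forall>t. poly G t \<noteq> 0 \<longrightarrow> poly2 \<psi> (poly F t / poly G t, poly H t / poly G t) = 0)"
  proof (rule implicit_equation_monic[of G F H])
    show "degree G < degree F" using gu by (simp add: degF degG)
    fix \<psi>
    assume "degree \<psi> = degree F" "lead_coeff \<psi> = 1"
      "\<And>t. poly G t \<noteq> 0 \<Longrightarrow> poly2 \<psi> (poly F t / poly G t, poly H t / poly G t) = 0"
    then show ?thesis unfolding degF by blast
  qed (rule coprime_FG)
  from someI_ex[OF this] show "degree psi = u" "coeff psi u = 1"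
    "poly G t \<noteq> 0 \<Longrightarrow> poly2 psi (poly F t / poly G t, poly H t / poly G t) = 0"
    unfolding psi_def[symmetric] by auto
qed

text \<open>For generic \<open>x\<close> this is the factorization of \<open>psi\<close> into linear factors in \<open>z\<close>.  For fixed \<open>z\<close>
  both sides are polynomials in \<open>x\<close>, so that it extends to the values of \<open>x\<close> for which the
  roots collide.\<close>

theorem psi_root_prod: "poly2 psi (x, z) = root_prod (pen x) (smult z G - H) / resG"
proof -
  have "\<exists>X. finite X \<and> (\<forall>x z. x \<notin> X \<longrightarrow>
     poly2 psi (x, z) = poly (coeff psi u) x * (\<Prod>t\<in>#proots (pen x). z - poly H t / poly G t))"
    by (rule generic_factorization[of psi "{}"]) (simp_all add: psi)
  then obtain X where X: "finite X" "\<And>x z. x \<notin> X \<Longrightarrow>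
      poly2 psi (x, z) = poly (coeff psi u) x * (\<Prod>t\<in>#proots (pen x). z - poly H t / poly G t)"
    by blast
  have gen: "poly2 psi (x, z) = root_prod (pen x) (smult z G - H) / resG" if x: "x \<notin> X" for x
  proof -
    have "root_prod (pen x) (smult z G - H) =
        (\<Prod>t\<in>#proots (pen x). poly G t * (z - poly H t / poly G t))"
      unfolding root_prod_def
    proof (intro arg_cong[where f = prod_mset] image_mset_cong)
      fix t assume "t \<in># proots (pen x)"
      then have "poly G t \<noteq> 0" using pen(3)[of x] pen_root by simp
      then show "poly (smult z G - H) t = poly G t * (z - poly H t / poly G t)"
        by (simp add: field_simps)
    qed
    also have "\<dots> = resG * poly2 psi (x, z)"
      using X(2)[OF x, of z] root_prod_pen_G(1)[of x] psi(2)
      by (simp add: prod_mset.distrib root_prod_def)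
    finally show ?thesis using root_prod_pen_G(2) by simp
  qed
  \<comment> \<open>The product over the moving roots is a polynomial in \<open>x\<close>.\<close>
  obtain P where P: "\<And>x. root_prod (pen x) (smult z G - H) = poly P x"
  proof (cases "smult z G = H")
    case True
    have "root_prod (pen x) (smult z G - H) = poly 0 x" for x
      using size_proots_pen[of x] gu by (simp add: root_prod_def True)
    then show thesis by (rule that)
  next
    case False
    show thesis
      by (rule that[of "smult ((-1) ^ (u * degree (smult z G - H)) * lead_coeff (smult z G - H) ^ u
            / lead_coeff F ^ degree (smult z G - H))
            (\<Prod>s\<in>#proots (smult z G - H). [:poly F s, - poly G s:])"])
        (simp only: root_prod_pen poly_smult)
  qed
  have "poly psi [:z:] = smult (1 / resG) P"
    by (rule poly_eqI_cofinite[OF X(1)]) (use gen P in \<open>simp add: poly2_def\<close>)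
  then have "poly (poly psi [:z:]) x = poly (smult (1 / resG) P) x" by simp
  then show ?thesis by (simp add: poly2_def P)
qed

end

section \<open>Inequalities for the exponents\<close>

lemma coeff_norm_extend: "degree p \<le> n \<Longrightarrow> coeff_norm s p = (\<Sum>m\<le>n. norm (coeff p m) * s ^ m)"
  unfolding coeff_norm_def by (rule sum.mono_neutral_left) (auto simp: coeff_eq_0)

text \<open>The factor with the order of \<open>p\<close> at \<open>0\<close> is what makes the estimate useful for small \<open>t\<close>.\<close>

lemma norm_poly_le_coeff_norm:
  assumes "degree p \<le> n"
  shows "norm (poly p t) \<le> coeff_norm 1 p * (norm t ^ order 0 p * (1 + norm t) ^ n)"
proof -
  have "norm (poly p t) \<le> (\<Sum>m\<le>degree p. norm (coeff p m * t ^ m))"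
    unfolding poly_altdef by (rule norm_sum)
  also have "\<dots> \<le> (\<Sum>m\<le>degree p. norm (coeff p m) * (norm t ^ order 0 p * (1 + norm t) ^ n))"
  proof (rule sum_mono)
    fix m assume m: "m \<in> {..degree p}"
    show "norm (coeff p m * t ^ m) \<le> norm (coeff p m) * (norm t ^ order 0 p * (1 + norm t) ^ n)"
    proof (cases "m < order 0 p")
      case True
      then show ?thesis by (simp add: coeff_below_order)
    next
      case False
      then have "norm t ^ m = norm t ^ order 0 p * norm t ^ (m - order 0 p)"
        by (simp flip: power_add)
      also have "\<dots> \<le> norm t ^ order 0 p * (1 + norm t) ^ (m - order 0 p)"
        by (intro mult_left_mono power_mono) auto
      also have "\<dots> \<le> norm t ^ order 0 p * (1 + norm t) ^ n"
        using m assms by (intro mult_left_mono power_increasing) auto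
      finally show ?thesis unfolding norm_mult norm_power by (rule mult_left_mono) simp
    qed
  qed
  also have "\<dots> = coeff_norm 1 p * (norm t ^ order 0 p * (1 + norm t) ^ n)"
    by (simp add: coeff_norm_def sum_distrib_right)
  finally show ?thesis .
qed

lemma norm_poly_le_coeff_norm_1:
  assumes "degree p \<le> n"
  shows "norm (poly p t) \<le> coeff_norm 1 p * (1 + norm t) ^ n"
proof -
  have "norm (poly p t) \<le> (\<Sum>m\<le>degree p. norm (coeff p m * t ^ m))"
    unfolding poly_altdef by (rule norm_sum)
  also have "\<dots> \<le> (\<Sum>m\<le>degree p. norm (coeff p m) * (1 + norm t) ^ n)"
  proof (rule sum_mono)
    fix m assume m: "m \<in> {..degree p}"
    have "norm t ^ m \<le> (1 + norm t) ^ m" by (intro power_mono) auto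
    also have "\<dots> \<le> (1 + norm t) ^ n" using m assms by (intro power_increasing) auto
    finally show "norm (coeff p m * t ^ m) \<le> norm (coeff p m) * (1 + norm t) ^ n"
      unfolding norm_mult norm_power by (rule mult_left_mono) simp
  qed
  also have "\<dots> = coeff_norm 1 p * (1 + norm t) ^ n"
    by (simp add: coeff_norm_def sum_distrib_right)
  finally show ?thesis .
qed

lemma coeff_norm_le_large_scale:
  assumes "s \<ge> 1" "degree p \<le> n"
  shows "coeff_norm s p \<le> coeff_norm 1 p * s ^ n"
  unfolding coeff_norm_def sum_distrib_right
proof (rule sum_mono)
  fix m assume "m \<in> {..degree p}"
  then have "s ^ m \<le> s ^ n" using assms by (intro power_increasing) auto
  then show "norm (coeff p m) * s ^ m \<le> norm (coeff p m) * 1 ^ m * s ^ n"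
    by (simp add: mult_left_mono)
qed

lemma coeff_norm_le_small_scale:
  assumes "0 \<le> s" "s \<le> 1"
  shows "coeff_norm s p \<le> coeff_norm 1 p * s ^ order 0 p"
  unfolding coeff_norm_def sum_distrib_right
proof (rule sum_mono)
  fix m
  show "norm (coeff p m) * s ^ m \<le> norm (coeff p m) * 1 ^ m * s ^ order 0 p"
  proof (cases "m < order 0 p")
    case True
    then show ?thesis by (simp add: coeff_below_order)
  next
    case False
    then have "s ^ m \<le> s ^ order 0 p" using assms by (intro power_decreasing) auto
    then show ?thesis by (simp add: mult_left_mono)
  qed
qed

lemma prod_mset_power: "(\<Prod>t\<in>#M. f t ^ n) = (\<Prod>t\<in>#M. f t :: 'a :: comm_semiring_1) ^ n"
  by (induction M) (auto simp: power_mult_distrib)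

lemma norm_prod_mset: "norm (\<Prod>t\<in>#M. f t :: complex) = (\<Prod>t\<in>#M. norm (f t))"
  by (induction M) (auto simp: norm_mult)

lemma prod_mset_nonneg: "(\<And>t. t \<in># M \<Longrightarrow> 0 \<le> f t) \<Longrightarrow> 0 \<le> (\<Prod>t\<in>#M. f t :: real)"
  by (induction M) auto

context pencil
begin

lemma coeff_norm_pen:
  assumes "s \<ge> 0"
  shows "coeff_norm s (pen x) \<le> coeff_norm s F + norm x * coeff_norm s G"
proof -
  have "coeff_norm s (pen x) = (\<Sum>m\<le>u. norm (coeff (pen x) m) * s ^ m)"
    by (simp add: coeff_norm_def pen)
  also have "\<dots> \<le> (\<Sum>m\<le>u. norm (coeff F m) * s ^ m + norm x * (norm (coeff G m) * s ^ m))"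
  proof (rule sum_mono)
    fix m
    have "norm (coeff (pen x) m) \<le> norm (coeff F m) + norm x * norm (coeff G m)"
      unfolding pen_def by (simp add: norm_triangle_ineq4 flip: norm_mult)
    then have "norm (coeff (pen x) m) * s ^ m \<le> (norm (coeff F m) + norm x * norm (coeff G m)) * s ^ m"
      using assms by (intro mult_right_mono) auto
    then show "norm (coeff (pen x) m) * s ^ m \<le> norm (coeff F m) * s ^ m + norm x * (norm (coeff G m) * s ^ m)"
      by (simp add: algebra_simps)
  qed
  also have "\<dots> = coeff_norm s F + norm x * coeff_norm s G"
    using gu by (simp add: coeff_norm_extend[of F u] coeff_norm_extend[of G u] degF degG
        sum.distrib sum_distrib_left)
  finally show ?thesis .
qed

definition root_const :: real where
  "root_const = (2 * real (Suc u)) ^ u / norm (lead_coeff F)"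

lemma root_const_nonneg: "root_const \<ge> 0"
  by (simp add: root_const_def)

lemma prod_roots_pen_le:
  assumes "s > 0"
  shows "(\<Prod>t\<in>#proots (pen x). s + norm t) \<le>
    root_const * (coeff_norm s F + norm x * coeff_norm s G)"
proof -
  define N where "N = (\<Prod>t\<in>#proots (pen x). s + norm t)"
  have l: "norm (lead_coeff F) > 0" using F0 by simp
  have "norm (lead_coeff F) * N \<le> (2 * real (Suc u)) ^ u * coeff_norm s (pen x)"
    using prod_roots_le_coeff_norm[OF assms, of "pen x"] unfolding pen(2) unfolding pen(1) N_def .
  also have "\<dots> \<le> (2 * real (Suc u)) ^ u * (coeff_norm s F + norm x * coeff_norm s G)"
    using coeff_norm_pen assms by (intro mult_left_mono) auto
  finally show ?thesis using l unfolding N_def[symmetric] root_const_def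
    by (simp add: pos_le_divide_eq mult.commute)
qed

lemma norm_psi_le:
  assumes "\<And>t. poly (pen x) t = 0 \<Longrightarrow> norm (z * poly G t - poly H t) \<le> \<beta> t"
  shows "norm (poly2 psi (x, z)) \<le> (\<Prod>t\<in>#proots (pen x). \<beta> t) / norm resG"
proof -
  have "norm (root_prod (pen x) (smult z G - H)) \<le> (\<Prod>t\<in>#proots (pen x). \<beta> t)"
    unfolding root_prod_def norm_prod_mset
    by (rule prod_mset_mono) (use assms pen(3) in auto)
  then show ?thesis by (simp add: psi_root_prod norm_divide divide_right_mono)
qed

text \<open>The behaviour at \<open>t = \<infinity>\<close>: with \<open>c = u - g\<close> scale \<open>x\<close> with \<open>s\<^sup>c\<close> and \<open>z\<close> with \<open>s\<^sup>c\<^sup>-\<^sup>d\<close>.  All roots of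
  \<open>F - x G\<close> are then of order at most \<open>s\<close>, and the product of the numbers \<open>1 + \<bar>t\<bar>\<close> is of order
  at most \<open>s\<^sup>c\<close>.  On a root \<open>z G(t)\<close> equals \<open>(z/x) F(t)\<close>, whose size is controlled by these two
  facts.  For the theorem \<open>d = u - h\<close> is the best choice, but \<open>d = 0\<close> is useful as well: it
  bounds the total degree.\<close>

theorem psi_weight_infinity:
  assumes d: "h \<le> u - d" "d \<le> u" and pq: "(p, q) \<in> supp2 psi"
  shows "real (u - g) * real p + (real (u - g) - real d) * real q \<le> real (u - g) * real (u - d)"
proof (rule supp2_weight_le_growth[OF _ pq])
  fix X Z :: complex assume XZ: "X \<noteq> 0" "Z \<noteq> 0"
  define c where "c = u - g"
  define B where "B = norm (Z / X) * coeff_norm 1 F + coeff_norm 1 H"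
  define K where "K = root_const * (coeff_norm 1 F + norm X * coeff_norm 1 G)"
  have B: "B \<ge> 0" unfolding B_def by (intro add_nonneg_nonneg mult_nonneg_nonneg coeff_norm_nonneg) auto
  have K: "K \<ge> 0" unfolding K_def
    by (intro add_nonneg_nonneg mult_nonneg_nonneg coeff_norm_nonneg root_const_nonneg) auto
  have "norm (poly2 psi (X * complex_of_real (s powr real c), Z * complex_of_real (s powr (real c - real d))))
      \<le> (B ^ u * (K ^ (u - d) * K ^ d) / norm resG) * s powr (real c * real (u - d))" if s: "s \<ge> 1" for s
  proof -
    define x where "x = X * complex_of_real (s powr real c)"
    define z where "z = Z * complex_of_real (s powr (real c - real d))"
    let ?R = "proots (pen x)"
    have nx: "norm x = norm X * s ^ c" using s by (simp add: x_def norm_mult norm_power powr_realpow)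
    have x0: "x \<noteq> 0" using XZ s by (simp add: x_def)
    have zx: "norm (z / x) = norm (Z / X) / s ^ d"
      using s by (simp add: x_def z_def norm_divide norm_mult norm_power powr_diff powr_realpow)
    have "norm (poly2 psi (x, z)) \<le> (\<Prod>t\<in>#?R. B * ((1 + norm t) ^ (u - d) * ((s + norm t) / s) ^ d)) / norm resG"
    proof (rule norm_psi_le)
      fix t assume t: "poly (pen x) t = 0"
      \<comment> \<open>Both terms are bounded by multiples of this: use \<open>1 + \<bar>t\<bar> \<le> s + \<bar>t\<bar>\<close> for the first and \<open>s \<le> s + \<bar>t\<bar>\<close> for the second.\<close>
      define A where "A = (1 + norm t) ^ (u - d) * ((s + norm t) / s) ^ d"
      have "z * poly G t = (z / x) * poly F t" using pen_root(2)[OF t] x0 by simp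
      then have "norm (z * poly G t - poly H t) \<le> norm (z / x) * norm (poly F t) + norm (poly H t)"
        by (metis norm_mult norm_triangle_ineq4)
      also have "norm (poly H t) \<le> coeff_norm 1 H * A"
      proof -
        have "norm (poly H t) \<le> coeff_norm 1 H * (1 + norm t) ^ (u - d)"
          using d degH by (intro norm_poly_le_coeff_norm_1) simp
        also have "1 \<le> ((s + norm t) / s) ^ d" using s by (intro one_le_power) simp
        then have "(1 + norm t) ^ (u - d) \<le> A" unfolding A_def
          by (metis mult.right_neutral mult_left_mono norm_ge_zero zero_le_power add_nonneg_nonneg zero_le_one)
        then have "coeff_norm 1 H * (1 + norm t) ^ (u - d) \<le> coeff_norm 1 H * A"
          by (intro mult_left_mono coeff_norm_nonneg) auto
        finally show ?thesis .
      qed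
      also have "norm (z / x) * norm (poly F t) \<le> norm (Z / X) * coeff_norm 1 F * A"
      proof -
        have "norm (poly F t) \<le> coeff_norm 1 F * (1 + norm t) ^ u"
          using degF by (intro norm_poly_le_coeff_norm_1) simp
        then have "norm (z / x) * norm (poly F t) \<le> (norm (Z / X) / s ^ d) * (coeff_norm 1 F * (1 + norm t) ^ u)"
          unfolding zx using s by (intro mult_left_mono) auto
        also have "\<dots> = norm (Z / X) * coeff_norm 1 F * ((1 + norm t) ^ (u - d) * ((1 + norm t) / s) ^ d)"
          using d by (simp add: power_divide flip: power_add)
        also have "\<dots> \<le> norm (Z / X) * coeff_norm 1 F * A" unfolding A_def
          using s by (intro mult_left_mono power_mono divide_right_mono mult_nonneg_nonneg coeff_norm_nonneg) auto
        finally show ?thesis .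
      qed
      finally show "norm (z * poly G t - poly H t) \<le> B * ((1 + norm t) ^ (u - d) * ((s + norm t) / s) ^ d)"
        unfolding A_def[symmetric] by (simp add: B_def distrib_right)
    qed
    also have "(\<Prod>t\<in>#?R. B * ((1 + norm t) ^ (u - d) * ((s + norm t) / s) ^ d)) =
        B ^ u * ((\<Prod>t\<in>#?R. 1 + norm t) ^ (u - d) * ((\<Prod>t\<in>#?R. s + norm t) / s ^ u) ^ d)"
    proof -
      have "(\<Prod>t\<in>#?R. s) = s ^ u" by (simp add: size_proots_pen)
      moreover have "(\<Prod>t\<in>#?R. (s + norm t) / s) * (\<Prod>t\<in>#?R. s) = (\<Prod>t\<in>#?R. (s + norm t) / s * s)"
        by (simp only: prod_mset.distrib)
      moreover have "(\<Prod>t\<in>#?R. (s + norm t) / s * s) = (\<Prod>t\<in>#?R. s + norm t)"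
        using s by simp
      ultimately have "(\<Prod>t\<in>#?R. (s + norm t) / s) = (\<Prod>t\<in>#?R. s + norm t) / s ^ u"
        using s by (simp add: eq_divide_eq)
      then show ?thesis by (simp add: prod_mset.distrib prod_mset_power size_proots_pen)
    qed
    also have "\<dots> \<le> B ^ u * ((K * s ^ c) ^ (u - d) * K ^ d)"
    proof (intro mult_left_mono mult_mono power_mono)
      have sc: "s ^ c \<ge> 1" using s by simp
      have "(\<Prod>t\<in>#?R. 1 + norm t) \<le> root_const * (coeff_norm 1 F + norm x * coeff_norm 1 G)"
        by (rule prod_roots_pen_le) simp
      also have "\<dots> \<le> root_const * (coeff_norm 1 F * s ^ c + norm x * coeff_norm 1 G)"
        using sc coeff_norm_nonneg[of 1 F] mult_left_mono[OF sc, of "coeff_norm 1 F"]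
        by (intro mult_left_mono root_const_nonneg) simp
      also have "\<dots> = K * s ^ c" by (simp add: K_def nx algebra_simps)
      finally show "(\<Prod>t\<in>#?R. 1 + norm t) \<le> K * s ^ c" .
      have "(\<Prod>t\<in>#?R. s + norm t) \<le> root_const * (coeff_norm s F + norm x * coeff_norm s G)"
        using s by (intro prod_roots_pen_le) simp
      also have "\<dots> \<le> root_const * (coeff_norm 1 F * s ^ u + norm x * (coeff_norm 1 G * s ^ g))"
        using s degF degG
        by (intro mult_left_mono add_mono coeff_norm_le_large_scale root_const_nonneg) auto
      also have "\<dots> = K * s ^ u"
      proof -
        have "s ^ c * s ^ g = s ^ u" using gu by (simp add: c_def flip: power_add)
        then show ?thesis unfolding K_def nx by (simp add: algebra_simps)
      qed
      finally show "(\<Prod>t\<in>#?R. s + norm t) / s ^ u \<le> K" using s by (simp add: divide_le_eq)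
    qed (use s B K in \<open>auto intro!: prod_mset_nonneg divide_nonneg_nonneg zero_le_power mult_nonneg_nonneg add_nonneg_nonneg\<close>)
    also have "\<dots> = B ^ u * (K ^ (u - d) * K ^ d) * s powr (real c * real (u - d))"
    proof -
      have "s powr (real c * real (u - d)) = (s ^ c) ^ (u - d)"
        using s by (simp add: powr_realpow flip: power_mult of_nat_mult)
      then show ?thesis by (simp add: power_mult_distrib)
    qed
    finally show ?thesis by (simp add: x_def z_def divide_right_mono)
  qed
  then show "\<exists>C. \<forall>s\<ge>1. norm (poly2 psi (X * complex_of_real (s powr real (u - g)),
      Z * complex_of_real (s powr (real (u - g) - real d)))) \<le> C * s powr (real (u - g) * real (u - d))"
    unfolding c_def by blast
qed

lemma psi_total_degree:
  assumes "(p, q) \<in> supp2 psi"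
  shows "p + q \<le> u"
proof -
  have "real (u - g) * (real p + real q) \<le> real (u - g) * real u"
    using psi_weight_infinity[of 0 p q] assms hu by (simp add: distrib_left)
  then show ?thesis using gu by (simp flip: of_nat_add)
qed

text \<open>The behaviour at \<open>t = 0\<close>: with \<open>\<sigma> = 1/s\<close> scale \<open>x\<close> with \<open>\<sigma>\<^sup>a\<close> and \<open>z\<close> with \<open>\<sigma>\<^sup>b\<close>.  The product of the
  numbers \<open>\<sigma> + \<bar>t\<bar>\<close> over the roots is of order at most \<open>\<sigma>\<^sup>a\<close>, because \<open>a\<close> of the roots tend to \<open>0\<close>,
  and each factor \<open>z G(t) - H(t)\<close> is at most of the order of \<open>(\<sigma> + \<bar>t\<bar>)\<^sup>b\<close>.\<close>

theorem psi_weight_zero: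
  assumes pq: "(p, q) \<in> supp2 psi"
  shows "real a * real b \<le> real a * real p + real b * real q"
proof -
  have "- real a * real p + - real b * real q \<le> - (real a * real b)"
  proof (rule supp2_weight_le_growth[OF _ pq])
    fix X Z :: complex assume XZ: "X \<noteq> 0" "Z \<noteq> 0"
    define B where "B = norm Z * coeff_norm 1 G + coeff_norm 1 H"
    define K where "K = root_const * (coeff_norm 1 F + norm X * coeff_norm 1 G)"
    have B: "B \<ge> 0" unfolding B_def by (intro add_nonneg_nonneg mult_nonneg_nonneg coeff_norm_nonneg) auto
    have K: "K \<ge> 0" unfolding K_def
      by (intro add_nonneg_nonneg mult_nonneg_nonneg coeff_norm_nonneg root_const_nonneg) auto
    have "norm (poly2 psi (X * complex_of_real (s powr (- real a)), Z * complex_of_real (s powr (- real b))))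
        \<le> (B ^ u * (K ^ b * K ^ u) / norm resG) * s powr (- (real a * real b))" if s: "s \<ge> 1" for s
    proof -
      define \<sigma> where "\<sigma> = 1 / s"
      have \<sigma>: "0 < \<sigma>" "\<sigma> \<le> 1" using s by (simp_all add: \<sigma>_def)
      have powr: "s powr (- real n) = \<sigma> ^ n" for n
        using s by (simp add: \<sigma>_def powr_minus_divide powr_realpow power_divide)
      define x where "x = X * complex_of_real (\<sigma> ^ a)"
      define z where "z = Z * complex_of_real (\<sigma> ^ b)"
      let ?R = "proots (pen x)"
      have nx: "norm x = norm X * \<sigma> ^ a" using \<sigma> by (simp add: x_def norm_mult norm_power)
      have nz: "norm z = norm Z * \<sigma> ^ b" using \<sigma> by (simp add: z_def norm_mult norm_power)
      have "norm (poly2 psi (x, z)) \<le> (\<Prod>t\<in>#?R. B * ((\<sigma> + norm t) ^ b * (1 + norm t) ^ u)) / norm resG"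
      proof (rule norm_psi_le)
        fix t :: complex
        define A where "A = (\<sigma> + norm t) ^ b * (1 + norm t) ^ u"
        have "norm (z * poly G t - poly H t) \<le> norm z * norm (poly G t) + norm (poly H t)"
          by (metis norm_mult norm_triangle_ineq4)
        also have "norm z * norm (poly G t) \<le> norm Z * coeff_norm 1 G * A"
        proof -
          have "norm (poly G t) \<le> coeff_norm 1 G * (1 + norm t) ^ u"
            using degG gu by (intro norm_poly_le_coeff_norm_1) simp
          then have "norm z * norm (poly G t) \<le> (norm Z * \<sigma> ^ b) * (coeff_norm 1 G * (1 + norm t) ^ u)"
            unfolding nz using \<sigma> by (intro mult_left_mono) auto
          also have "\<dots> = norm Z * coeff_norm 1 G * (\<sigma> ^ b * (1 + norm t) ^ u)" by simp
          also have "\<dots> \<le> norm Z * coeff_norm 1 G * A" unfolding A_def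
            using \<sigma> by (intro mult_left_mono mult_right_mono power_mono mult_nonneg_nonneg coeff_norm_nonneg) auto
          finally show ?thesis .
        qed
        also have "norm (poly H t) \<le> coeff_norm 1 H * A"
        proof -
          have "norm (poly H t) \<le> coeff_norm 1 H * (norm t ^ b * (1 + norm t) ^ u)"
            using norm_poly_le_coeff_norm[of H u t] degH hu by (simp add: ordH)
          also have "\<dots> \<le> coeff_norm 1 H * A" unfolding A_def
            using \<sigma> by (intro mult_left_mono mult_right_mono power_mono coeff_norm_nonneg) auto
          finally show ?thesis .
        qed
        finally show "norm (z * poly G t - poly H t) \<le> B * ((\<sigma> + norm t) ^ b * (1 + norm t) ^ u)"
          unfolding A_def[symmetric] by (simp add: B_def distrib_right)
      qed
      also have "(\<Prod>t\<in>#?R. B * ((\<sigma> + norm t) ^ b * (1 + norm t) ^ u)) =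
          B ^ u * ((\<Prod>t\<in>#?R. \<sigma> + norm t) ^ b * (\<Prod>t\<in>#?R. 1 + norm t) ^ u)"
        by (simp add: prod_mset.distrib prod_mset_power size_proots_pen)
      also have "\<dots> \<le> B ^ u * ((K * \<sigma> ^ a) ^ b * K ^ u)"
      proof (intro mult_left_mono mult_mono power_mono)
        have \<sigma>a: "\<sigma> ^ a \<le> 1" using \<sigma> by (simp add: power_le_one)
        have "(\<Prod>t\<in>#?R. 1 + norm t) \<le> root_const * (coeff_norm 1 F + norm x * coeff_norm 1 G)"
          by (rule prod_roots_pen_le) simp
        also have "\<dots> \<le> K" unfolding K_def nx
          using mult_left_mono[OF \<sigma>a, of "norm X"]
          by (intro mult_left_mono add_left_mono mult_right_mono root_const_nonneg coeff_norm_nonneg) auto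
        finally show "(\<Prod>t\<in>#?R. 1 + norm t) \<le> K" .
        have "(\<Prod>t\<in>#?R. \<sigma> + norm t) \<le> root_const * (coeff_norm \<sigma> F + norm x * coeff_norm \<sigma> G)"
          using \<sigma> by (intro prod_roots_pen_le) simp
        also have "\<dots> \<le> root_const * (coeff_norm 1 F * \<sigma> ^ a + norm x * coeff_norm 1 G)"
        proof (intro mult_left_mono add_mono root_const_nonneg)
          show "coeff_norm \<sigma> F \<le> coeff_norm 1 F * \<sigma> ^ a"
            using coeff_norm_le_small_scale[of \<sigma> F] \<sigma> by (simp add: ordF)
          have "order 0 G = 0" using poly_G_0 by (simp add: order_0I)
          then show "coeff_norm \<sigma> G \<le> coeff_norm 1 G"
            using coeff_norm_le_small_scale[of \<sigma> G] \<sigma> by simp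
        qed simp
        also have "\<dots> = K * \<sigma> ^ a" unfolding K_def nx by (simp add: algebra_simps)
        finally show "(\<Prod>t\<in>#?R. \<sigma> + norm t) \<le> K * \<sigma> ^ a" .
      qed (use \<sigma> B K in \<open>auto intro!: prod_mset_nonneg zero_le_power mult_nonneg_nonneg add_nonneg_nonneg\<close>)
      also have "\<dots> = B ^ u * (K ^ b * K ^ u) * s powr (- (real a * real b))"
        using powr[of "a * b"] by (simp add: power_mult_distrib power_mult)
      finally show ?thesis unfolding powr by (simp add: x_def z_def divide_right_mono)
    qed
    then show "\<exists>C. \<forall>s\<ge>1. norm (poly2 psi (X * complex_of_real (s powr - real a),
        Z * complex_of_real (s powr - real b))) \<le> C * s powr - (real a * real b)"
      by blast
  qed
  then show ?thesis by simp
qed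

end

section \<open>Exponents on the sides of the triangle\<close>

lemma coeff_prod_linear_top:
  "coeff (\<Prod>s\<in>#M. [:\<alpha> s, \<beta> s:]) (size M) = (\<Prod>s\<in>#M. \<beta> s :: 'a :: comm_ring_1)"
proof -
  have "coeff (\<Prod>s\<in>#M. [:\<alpha> s, \<beta> s:]) (size M) = (\<Prod>s\<in>#M. \<beta> s) \<and>
      degree (\<Prod>s\<in>#M. [:\<alpha> s, \<beta> s:]) \<le> size M"
  proof (induction M)
    case (add s M)
    let ?P = "\<Prod>s\<in>#M. [:\<alpha> s, \<beta> s:]"
    have "coeff ([:\<alpha> s, \<beta> s:] * ?P) (Suc (size M)) = \<beta> s * (\<Prod>s\<in>#M. \<beta> s)"
      using add by (simp add: coeff_eq_0)
    moreover have "degree ([:\<alpha> s, \<beta> s:] * ?P) \<le> Suc (size M)"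
      using add degree_mult_le[of "[:\<alpha> s, \<beta> s:]" ?P]
      by (intro order.trans[OF degree_mult_le]) (auto intro: le_trans[OF add_mono[OF degree_pCons_le]])
    ultimately show ?case by (simp del: mult_pCons_left)
  qed simp
  then show ?thesis by simp
qed

context pencil
begin

text \<open>On the side \<open>z = 0\<close> the implicit equation has the roots \<open>x = F(s)/G(s)\<close> for the roots \<open>s\<close>
  of \<open>H\<close>.\<close>

lemma psi_side_H:
  obtains c where "c \<noteq> 0" "coeff psi 0 = smult c (\<Prod>s\<in>#proots H. [:poly F s, - poly G s:])"
proof -
  define c where "c = (-1) ^ (u * h) * lead_coeff (-H) ^ u / lead_coeff F ^ h / resG"
  have "c \<noteq> 0" using F0 H0 root_prod_pen_G(2) by (simp add: c_def)
  moreover have "coeff psi 0 = smult c (\<Prod>s\<in>#proots H. [:poly F s, - poly G s:])"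
  proof (rule poly_eqI_cofinite[of "{}"])
    fix x
    have "poly (coeff psi 0) x = poly2 psi (x, 0)" by (simp add: poly2_def poly_0_coeff_0)
    also have "\<dots> = root_prod (pen x) (-H) / resG" by (simp add: psi_root_prod)
    also have "\<dots> = poly (smult c (\<Prod>s\<in>#proots H. [:poly F s, - poly G s:])) x"
      unfolding root_prod_pen c_def by (simp add: degH)
    finally show "poly (coeff psi 0) x = poly (smult c (\<Prod>s\<in>#proots H. [:poly F s, - poly G s:])) x" .
  qed simp
  ultimately show thesis by (rule that)
qed

text \<open>The two ends of the side \<open>z = 0\<close>.  No root of \<open>H\<close> is one of \<open>G\<close>, so the degree in \<open>x\<close> is \<open>h\<close>;
  only the root \<open>0\<close>, of multiplicity \<open>b\<close>, is shared with \<open>F\<close>.\<close>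

lemma psi_corners_H: "(h, 0) \<in> supp2 psi" "(b, 0) \<in> supp2 psi"
proof -
  define P where "P = (\<Prod>s\<in>#proots H. [:poly F s, - poly G s:])"
  obtain c where c: "c \<noteq> 0" "coeff psi 0 = smult c P" unfolding P_def by (rule psi_side_H)
  have "poly F s \<noteq> 0 \<or> - poly G s \<noteq> 0" for s using FG[of s] by auto
  note P = prod_linear_factors[of "proots H" "poly F" "\<lambda>s. - poly G s", OF this, folded P_def]
  have "filter_mset (\<lambda>s. - poly G s \<noteq> 0) (proots H) = proots H"
    using GH H0 by (intro filter_mset_eq_conv[THEN iffD2]) (auto simp: filter_mset_eq_conv)
  then have "degree P = h" using P(2) by (simp add: size_proots_complex degH)
  then show "(h, 0) \<in> supp2 psi" using P(1) c by (auto simp: supp2_def)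
  have "size (filter_mset (\<lambda>s. poly F s = 0) (proots H)) = count (proots H) 0"
    using FH H0 poly_F_0 by (intro size_filter_eq_const) auto
  then have "order 0 P = b" using P(3) H0 ordH by simp
  then show "(b, 0) \<in> supp2 psi" using coeff_order_nonzero[OF P(1)] c by (simp add: supp2_def)
qed

text \<open>On the side \<open>x = 0\<close> the roots \<open>z = H(t)/G(t)\<close> come from the roots \<open>t\<close> of \<open>F\<close>, and they vanish
  only for \<open>t = 0\<close>, which has multiplicity \<open>a\<close>.\<close>

lemma psi_corner_F:
  assumes "b > 0"
  shows "(0, a) \<in> supp2 psi"
proof -
  define P where "P = (\<Prod>t\<in>#proots F. [:- poly H t, poly G t:])"
  have "- poly H t \<noteq> 0 \<or> poly G t \<noteq> 0" for t using GH[of t] by auto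
  note P = prod_linear_factors[of "proots F" "\<lambda>t. - poly H t" "poly G", OF this, folded P_def]
  define p where "p = map_poly (\<lambda>q. poly q 0) psi"
  have "p = smult (1 / resG) P"
  proof (rule poly_eqI_cofinite[of "{}"])
    fix z
    have "poly p z = root_prod (pen 0) (smult z G - H) / resG"
      by (simp add: p_def poly2_eq_poly_map[symmetric] psi_root_prod)
    also have "root_prod (pen 0) (smult z G - H) = poly P z"
      by (simp add: P_def root_prod_def pen_def poly_prod_mset image_mset.compositionality o_def algebra_simps)
    finally show "poly p z = poly (smult (1 / resG) P) z" by simp
  qed simp
  moreover have "coeff P a \<noteq> 0"
  proof -
    have "poly H 0 = 0" using assms ordH order_0I by fastforce
    then have "size (filter_mset (\<lambda>t. - poly H t = 0) (proots F)) = count (proots F) 0"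
      using FH F0 by (intro size_filter_eq_const) auto
    then have "order 0 P = a" using P(3) F0 ordF by simp
    then show ?thesis using coeff_order_nonzero[OF P(1)] by simp
  qed
  ultimately have "coeff p a \<noteq> 0" using root_prod_pen_G(2) by simp
  then show ?thesis by (simp add: p_def coeff_map_poly supp2_def poly_0_coeff_0)
qed

lemma psi_corner_top: "(0, u) \<in> supp2 psi"
  using psi(2) by (simp add: supp2_def)

text \<open>The side of the exponents of total degree \<open>u\<close> belongs to the roots of \<open>G\<close>, which lie at
  infinity in the chart.  On the line \<open>z = \<rho> x\<close> the equation of the curve is a product over
  the roots of \<open>\<rho> F - H\<close>.  Its top coefficient in \<open>x\<close> is a product of values of \<open>G\<close> at these
  roots, and a second swap turns it into a product over the roots of \<open>G\<close>.\<close>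

lemma psi_corner_G:
  assumes hu: "h < u" and tdeg: "\<And>p q. (p, q) \<in> supp2 psi \<Longrightarrow> p + q \<le> u"
  shows "(g, u - g) \<in> supp2 psi"
proof -
  let ?c = "\<lambda>p q. coeff (coeff psi q) p"
  define l where "l = lead_coeff F"
  define m where "m = lead_coeff G"
  have l: "l \<noteq> 0" and m: "m \<noteq> 0" using F0 G0 by (simp_all add: l_def m_def)
  \<comment> \<open>the coefficient of \<open>x\<^sup>u\<close> in \<open>psi(x, \<rho> x)\<close>, as a polynomial in \<open>\<rho>\<close>\<close>
  define T where "T = (\<Sum>(p, q)\<in>supp2 psi. if p + q = u then monom (?c p q) q else 0)"
  define P where "P = (\<Prod>r\<in>#proots G. [:- poly H r, poly F r:])"
  define k where "k = (-1) ^ (u * u) * (-1) ^ u * (-1) ^ (u * g) * m ^ u / l ^ g / resG"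
  have k: "k \<noteq> 0" using l m root_prod_pen_G(2) by (simp add: k_def)
  have key: "\<rho> ^ g * poly T \<rho> = k * (\<rho> ^ u * poly P \<rho>)" if \<rho>: "\<rho> \<noteq> 0" for \<rho>
  proof -
    define R where "R = smult \<rho> F - H"
    have degR: "degree R = u"
      unfolding R_def using hu \<rho> degF degH
      by (metis degree_add_eq_left degree_minus degree_smult_eq diff_conv_add_uminus)
    have lcR: "coeff R u = \<rho> * l"
      using hu degF degH by (simp add: R_def l_def coeff_eq_0)
    define L where "L = (\<Sum>(p, q)\<in>supp2 psi. monom (?c p q * \<rho> ^ q) (p + q))"
    define Q where "Q = (\<Prod>s\<in>#proots R. [:poly F s, - poly G s:])"
    define k' where "k' = (-1) ^ (u * u) * (\<rho> * l) ^ u / l ^ u / resG"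
    have "L = smult k' Q"
    proof (rule poly_eqI_cofinite[of "{0}"])
      fix x :: complex assume x: "x \<notin> {0}"
      have "poly L x = poly2 psi (x, \<rho> * x)"
        unfolding poly2_expand[OF finite_supp2 order_refl] L_def
        by (simp add: poly_sum poly_monom case_prod_unfold power_add power_mult_distrib mult_ac)
      also have "\<dots> = root_prod (pen x) (smult (\<rho> * x) G - H) / resG" by (rule psi_root_prod)
      also have "root_prod (pen x) (smult (\<rho> * x) G - H) = root_prod (pen x) R"
        unfolding root_prod_def
      proof (intro arg_cong[where f = prod_mset] image_mset_cong)
        fix t assume "t \<in># proots (pen x)"
        then have "poly F t = x * poly G t" using pen(3)[of x] pen_root by simp
        then show "poly (smult (\<rho> * x) G - H) t = poly R t" by (simp add: R_def)
      qed
      finally show "poly L x = poly (smult k' Q) x"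
        unfolding root_prod_pen Q_def[symmetric] k'_def degR lcR l_def[symmetric] by simp
    qed simp
    then have "coeff L u = k' * coeff Q u" by simp
    also have "coeff Q u = (\<Prod>s\<in>#proots R. - poly G s)"
      using coeff_prod_linear_top[of "poly F" "\<lambda>s. - poly G s" "proots R"]
      by (simp add: Q_def size_proots_complex degR)
    also have "\<dots> = (-1) ^ u * root_prod R G"
    proof -
      have "(\<Prod>s\<in>#proots R. (-1) * poly G s) = (-1) ^ u * root_prod R G"
        unfolding root_prod_def prod_mset.distrib by (simp add: size_proots_complex degR)
      then show ?thesis by simp
    qed
    finally have LT: "coeff L u = k' * ((-1) ^ u * root_prod R G)" .
    have "coeff L u = poly T \<rho>"
      unfolding L_def T_def by (simp add: coeff_sum poly_sum case_prod_unfold, intro sum.cong) (auto simp: poly_monom)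
    with LT have T: "poly T \<rho> = k' * ((-1) ^ u * root_prod R G)" by simp
    have "(\<rho> * l) ^ g * root_prod R G = (-1) ^ (u * g) * (m ^ u * root_prod G R)"
      using root_prod_swap[of R G] by (simp only: degR lcR degG m_def)
    moreover have "root_prod G R = poly P \<rho>"
      by (simp add: P_def R_def root_prod_def poly_prod_mset image_mset.compositionality o_def algebra_simps)
    ultimately have S: "\<rho> ^ g * root_prod R G = (-1) ^ (u * g) * m ^ u * poly P \<rho> / l ^ g"
      using l by (simp add: field_simps)
    have "\<rho> ^ g * poly T \<rho> = k' * (-1) ^ u * (\<rho> ^ g * root_prod R G)" by (simp add: T)
    also have "\<dots> = k * (\<rho> ^ u * poly P \<rho>)"
      unfolding S k_def k'_def using l by (simp add: power_mult_distrib mult_ac)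
    finally show ?thesis .
  qed
  have "monom 1 g * T = smult k (monom 1 u * P)"
    by (rule poly_eqI_cofinite[of "{0}"]) (use key in \<open>auto simp: poly_monom\<close>)
  then have "coeff (monom 1 g * T) u = coeff (smult k (monom 1 u * P)) u" by simp
  then have "coeff T (u - g) = k * coeff P 0" using gu by (simp add: coeff_monom_mult)
  also have "coeff P 0 = poly P 0" by (simp add: poly_0_coeff_0)
  also have "\<dots> = (\<Prod>r\<in>#proots G. - poly H r)"
    by (simp add: P_def poly_prod_mset image_mset.compositionality o_def)
  finally have "coeff T (u - g) = k * (\<Prod>r\<in>#proots G. - poly H r)" .
  moreover have "(\<Prod>r\<in>#proots G. - poly H r) \<noteq> 0" using GH G0 by auto
  ultimately have "coeff T (u - g) \<noteq> 0" using k by simp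
  moreover have "coeff T (u - g) = ?c g (u - g)"
  proof -
    have "coeff (case e of (p, q) \<Rightarrow> if p + q = u then monom (?c p q) q else 0) (u - g) =
        (if e = (g, u - g) then ?c g (u - g) else 0)" for e
      using gu by (cases e) auto
    then have "coeff T (u - g) = (\<Sum>e\<in>supp2 psi. if e = (g, u - g) then ?c g (u - g) else 0)"
      unfolding T_def coeff_sum by simp
    also have "\<dots> = ?c g (u - g)" by simp (simp add: supp2_def)
    finally show ?thesis .
  qed
  ultimately show ?thesis by (simp add: supp2_def)
qed

end

section \<open>Change of affine chart\<close>

text \<open>Pairs in this triangle encode the exponents of homogeneous polynomials of degree \<open>u\<close> in
  three variables: the third exponent is determined by the degree.\<close>

definition tri :: "nat \<Rightarrow> (nat \<times> nat) set" where
  "tri u = {(p, q). p + q \<le> u}"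

lemma finite_tri [simp]: "finite (tri u)"
  by (rule finite_subset[of _ "{..u} \<times> {..u}"]) (auto simp: tri_def)

text \<open>The exponent of the variable number \<open>l\<close> if the pair holds the exponents of the variables \<open>r\<close>
  and \<open>s\<close>.\<close>

definition expo :: "nat \<Rightarrow> nat \<Rightarrow> nat \<Rightarrow> nat \<times> nat \<Rightarrow> nat \<Rightarrow> nat" where
  "expo u r s e l = (if l = r then fst e else if l = s then snd e else u - fst e - snd e)"

definition rechart :: "nat \<Rightarrow> nat \<Rightarrow> nat \<Rightarrow> nat \<Rightarrow> nat \<Rightarrow> nat \<times> nat \<Rightarrow> nat \<times> nat" where
  "rechart u r s r' s' e = (expo u r s e r', expo u r s e s')"

text \<open>The chart with the coordinates \<open>X\<^sub>r/X\<^sub>t\<close> and \<open>X\<^sub>s/X\<^sub>t\<close>.\<close>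

definition is_chart :: "nat \<Rightarrow> nat \<Rightarrow> nat \<Rightarrow> bool" where
  "is_chart r s t \<longleftrightarrow> {r, s, t} = {0, 1, 2}"

lemma is_chart_cases:
  assumes "is_chart r s t"
  obtains "r = 0" "s = 1" "t = 2" | "r = 0" "s = 2" "t = 1" | "r = 1" "s = 0" "t = 2"
    | "r = 1" "s = 2" "t = 0" | "r = 2" "s = 0" "t = 1" | "r = 2" "s = 1" "t = 0"
proof -
  have "0 \<in> {r, s, t}" "1 \<in> {r, s, t}" "2 \<in> {r, s, t}"
    using assms unfolding is_chart_def by blast+
  then have "r = 0 \<or> s = 0 \<or> t = 0" "r = 1 \<or> s = 1 \<or> t = 1" "r = 2 \<or> s = 2 \<or> t = 2"
    by auto
  then show thesis by (elim disjE) (use that in simp_all)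
qed

lemma rechart_tri: "is_chart r s t \<Longrightarrow> is_chart r' s' t' \<Longrightarrow> e \<in> tri u \<Longrightarrow> rechart u r s r' s' e \<in> tri u"
  by (elim is_chart_cases) (auto simp: tri_def rechart_def expo_def)

lemma rechart_rechart:
  "is_chart r s t \<Longrightarrow> is_chart r' s' t' \<Longrightarrow> e \<in> tri u \<Longrightarrow>
    rechart u r' s' r s (rechart u r s r' s' e) = e"
  by (elim is_chart_cases) (auto simp: tri_def rechart_def expo_def)

lemma expo_rechart:
  "is_chart r s t \<Longrightarrow> is_chart r' s' t' \<Longrightarrow> e \<in> tri u \<Longrightarrow> l \<in> {0, 1, 2} \<Longrightarrow>
    expo u r' s' (rechart u r s r' s' e) l = expo u r s e l"
  by (elim is_chart_cases) (auto simp: tri_def rechart_def expo_def)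

abbreviation coeff2 :: "complex poly poly \<Rightarrow> nat \<times> nat \<Rightarrow> complex" where
  "coeff2 f e \<equiv> coeff (coeff f (snd e)) (fst e)"

lemma supp2_iff: "e \<in> supp2 f \<longleftrightarrow> coeff2 f e \<noteq> 0"
  by (cases e) (simp add: supp2_def)

text \<open>Homogenize to degree \<open>u\<close> and set another variable to one.  Fixing the degree \<open>u\<close>, which may
  exceed the total degree of \<open>f\<close>, makes the operation a bijection of coefficients.\<close>

definition chart_change ::
    "nat \<Rightarrow> nat \<Rightarrow> nat \<Rightarrow> nat \<Rightarrow> nat \<Rightarrow> complex poly poly \<Rightarrow> complex poly poly" where
  "chart_change u r s r' s' f = (\<Sum>e\<in>tri u.
     monom (monom (coeff2 f (rechart u r' s' r s e)) (fst e)) (snd e))"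

lemma coeff2_chart_change:
  "coeff2 (chart_change u r s r' s' f) e =
    (if e \<in> tri u then coeff2 f (rechart u r' s' r s e) else 0)"
proof -
  have "coeff2 (chart_change u r s r' s' f) e =
      (\<Sum>d\<in>tri u. if d = e then coeff2 f (rechart u r' s' r s e) else 0)"
    unfolding chart_change_def coeff_sum by (intro sum.cong) (auto simp: prod_eq_iff)
  then show ?thesis by simp
qed

lemma supp2_chart_change: "supp2 (chart_change u r s r' s' f) \<subseteq> tri u"
  by (rule subsetI) (simp add: supp2_iff coeff2_chart_change split: if_splits)

text \<open>The value of the homogeneous form of degree \<open>u\<close> whose dehomogenization is \<open>f\<close>.\<close>

definition form_eval :: "nat \<Rightarrow> nat \<Rightarrow> nat \<Rightarrow> complex poly poly \<Rightarrow> (nat \<Rightarrow> complex) \<Rightarrow> complex" where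
  "form_eval u r s f X = (\<Sum>e\<in>tri u. coeff2 f e * (\<Prod>l\<in>{0, 1, 2}. X l ^ expo u r s e l))"

lemma form_eval_chart_change:
  assumes "is_chart r s t" "is_chart r' s' t'"
  shows "form_eval u r' s' (chart_change u r s r' s' f) X = form_eval u r s f X"
  unfolding form_eval_def
proof (rule sum.reindex_bij_witness[of _ "rechart u r s r' s'" "rechart u r' s' r s"])
  fix e assume e: "e \<in> tri u"
  have "(\<Prod>l\<in>{0, 1, 2}. X l ^ expo u r s (rechart u r' s' r s e) l) =
      (\<Prod>l\<in>{0, 1, 2}. X l ^ expo u r' s' e l)"
    using expo_rechart[OF assms(2,1) e] by (intro prod.cong refl arg_cong[where f = "power _"]) blast
  then show "coeff2 f (rechart u r' s' r s e) * (\<Prod>l\<in>{0, 1, 2}. X l ^ expo u r s (rechart u r' s' r s e) l)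
     = coeff2 (chart_change u r s r' s' f) e * (\<Prod>l\<in>{0, 1, 2}. X l ^ expo u r' s' e l)"
    by (simp only: coeff2_chart_change e if_True)
qed (use assms rechart_tri rechart_rechart in blast)+

lemma form_eval_eq_poly2:
  assumes "is_chart r s t" "supp2 f \<subseteq> tri u" "X t \<noteq> 0"
  shows "form_eval u r s f X = X t ^ u * poly2 f (X r / X t, X s / X t)"
proof -
  have "(\<Prod>l\<in>{0, 1, 2}. X l ^ expo u r s e l) = X t ^ u * ((X r / X t) ^ fst e * (X s / X t) ^ snd e)"
    if e: "e \<in> tri u" for e
  proof -
    have "X t ^ u = X t ^ (u - fst e - snd e) * X t ^ fst e * X t ^ snd e"
      using e by (auto simp: tri_def simp flip: power_add)
    then have "X t ^ u * ((X r / X t) ^ fst e * (X s / X t) ^ snd e) =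
        X t ^ (u - fst e - snd e) * X r ^ fst e * X s ^ snd e"
      using assms(3) by (simp add: power_divide)
    also have "\<dots> = (\<Prod>l\<in>{0, 1, 2}. X l ^ expo u r s e l)"
      using assms(1) by (elim is_chart_cases) (simp_all add: expo_def)
    finally show ?thesis by simp
  qed
  then have "form_eval u r s f X =
      (\<Sum>e\<in>tri u. coeff2 f e * (X t ^ u * ((X r / X t) ^ fst e * (X s / X t) ^ snd e)))"
    unfolding form_eval_def by (intro sum.cong refl) simp
  also have "\<dots> = X t ^ u * poly2 f (X r / X t, X s / X t)"
    unfolding poly2_expand[OF finite_tri assms(2)]
    by (simp add: sum_distrib_left case_prod_unfold mult_ac)
  finally show ?thesis .
qed

lemma form_eval_eq_0_iff:
  assumes "is_chart r s t" "supp2 f \<subseteq> tri u" "X t \<noteq> 0"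
  shows "form_eval u r s f X = 0 \<longleftrightarrow> poly2 f (X r / X t, X s / X t) = 0"
  unfolding form_eval_eq_poly2[where X = X, OF assms] using assms(3) by simp

text \<open>Parameters at which a denominator vanishes can be ignored, because the form evaluated
  along the parameterization is a polynomial in \<open>t\<close>.\<close>

lemma form_eval_vanish_cofinite:
  fixes P :: "nat \<Rightarrow> complex poly"
  assumes "finite B" "\<And>t. t \<notin> B \<Longrightarrow> form_eval u r s f (\<lambda>l. poly (P l) t) = 0"
  shows "form_eval u r s f (\<lambda>l. poly (P l) t) = 0"
proof -
  define h where "h = (\<Sum>e\<in>tri u. smult (coeff2 f e) (\<Prod>l\<in>{0, 1, 2}. P l ^ expo u r s e l))"
  have h: "poly h t = form_eval u r s f (\<lambda>l. poly (P l) t)" for t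
    by (simp add: h_def form_eval_def poly_sum poly_prod)
  have "h = 0" by (rule poly_eqI_cofinite[OF assms(1)]) (simp add: h assms(2))
  then show ?thesis using h[of t] by simp
qed

text \<open>The total degree of a factor is at most that of the product.  Restriction to a generic
  line through the origin reduces this to one variable.\<close>

lemma supp2_factor_tri:
  assumes fg: "f * g \<noteq> 0" and tri: "supp2 (f * g) \<subseteq> tri u"
  shows "supp2 f \<subseteq> tri u"
proof
  fix e0 assume e0: "e0 \<in> supp2 f"
  define D where "D = fst e0 + snd e0"
  define S where "S = {e \<in> supp2 f. fst e + snd e = D}"
  define top where "top = (\<Sum>e\<in>S. monom (monom (coeff2 f e) (fst e)) (snd e))"
  have finS: "finite S" by (simp add: S_def)
  have ctop: "coeff2 top e = (if e \<in> S then coeff2 f e else 0)" for e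
  proof -
    have "coeff2 top e = (\<Sum>d\<in>S. if d = e then coeff2 f e else 0)"
      unfolding top_def coeff_sum by (intro sum.cong) (auto simp: prod_eq_iff)
    then show ?thesis using finS by simp
  qed
  have "coeff2 top e0 \<noteq> 0" using e0 by (simp add: ctop S_def D_def supp2_iff)
  then have "top * g \<noteq> 0" using fg by auto
  then obtain X Z where "poly2 (top * g) (X, Z) \<noteq> 0"
    using poly2_nonzero_point[of "top * g" "{}"] by auto
  then have XZ: "poly2 top (X, Z) \<noteq> 0" "poly2 g (X, Z) \<noteq> 0" by (auto simp: poly2_def)
  define L where "L f = (\<Sum>e\<in>supp2 f. monom (coeff2 f e * X ^ fst e * Z ^ snd e) (fst e + snd e))" for f
  have L: "poly (L f) \<tau> = poly2 f (X * \<tau>, Z * \<tau>)" for f \<tau>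
    unfolding poly2_expand[OF finite_supp2 order_refl] L_def
    by (simp add: poly_sum poly_monom case_prod_unfold power_mult_distrib power_add mult_ac)
  have mult: "L (f * g) = L f * L g"
    by (rule poly_eqI_cofinite[of "{}"]) (auto simp: L poly2_def)
  have "coeff (L f) D = poly2 top (X, Z)"
  proof -
    have "supp2 top \<subseteq> S" by (rule subsetI) (simp add: supp2_iff ctop split: if_splits)
    then have "poly2 top (X, Z) = (\<Sum>e\<in>S. coeff2 f e * X ^ fst e * Z ^ snd e)"
      unfolding poly2_expand[OF finS \<open>supp2 top \<subseteq> S\<close>]
      by (intro sum.cong refl) (simp add: ctop case_prod_unfold)
    also have "\<dots> = (\<Sum>e\<in>supp2 f. if fst e + snd e = D then coeff2 f e * X ^ fst e * Z ^ snd e else 0)"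
      unfolding S_def by (rule sum.inter_filter) simp
    also have "\<dots> = coeff (L f) D" by (simp add: L_def coeff_sum)
    finally show ?thesis by simp
  qed
  then have "L f \<noteq> 0" "D \<le> degree (L f)" using XZ by (auto intro: le_degree)
  moreover have "L g \<noteq> 0" using L[of g 1] XZ by auto
  ultimately have "D \<le> degree (L (f * g))" unfolding mult by (simp add: degree_mult_eq)
  also have "degree (L (f * g)) \<le> u"
    unfolding L_def using tri
    by (intro degree_sum_le) (auto simp: tri_def intro!: order.trans[OF degree_monom_le])
  finally show "e0 \<in> tri u" by (simp add: D_def tri_def case_prod_unfold)
qed

context pencil
begin

text \<open>The factor left open by \<open>generic_factorization\<close> is the coefficient of \<open>z\<^sup>u\<close>, and a bound \<open>u\<close>
  for the total degree forces that coefficient to be constant.\<close>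

lemma psi_unique:
  assumes f: "f \<noteq> 0" "supp2 f \<subseteq> tri u"
    and vanish: "\<And>t. poly G t \<noteq> 0 \<Longrightarrow> poly2 f (poly F t / poly G t, poly H t / poly G t) = 0"
  obtains c where "c \<noteq> 0" "f = smult [:c:] psi"
proof -
  have tri: "p + q \<le> u" if "coeff (coeff f q) p \<noteq> 0" for p q
    using f(2) that by (auto simp: supp2_def tri_def)
  have deg: "degree f \<le> u"
  proof (rule degree_le, intro allI impI)
    fix q assume "u < q"
    then have "coeff (coeff f q) p = 0" for p using tri[of q p] by auto
    then show "coeff f q = 0" by (simp add: poly_eq_iff)
  qed
  define c where "c = coeff (coeff f u) 0"
  have "coeff f u = [:c:]"
  proof (rule poly_eqI)
    fix p show "coeff (coeff f u) p = coeff [:c:] p"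
      using tri[of u p] by (cases p) (auto simp: c_def)
  qed
  have "\<exists>X. finite X \<and> (\<forall>x z. x \<notin> X \<longrightarrow>
     poly2 f (x, z) = poly (coeff f u) x * (\<Prod>t\<in>#proots (pen x). z - poly H t / poly G t))"
    by (rule generic_factorization[OF deg, of "{}"]) (simp_all add: vanish)
  then obtain X where X: "finite X" "\<And>x z. x \<notin> X \<Longrightarrow>
     poly2 f (x, z) = c * (\<Prod>t\<in>#proots (pen x). z - poly H t / poly G t)"
    using \<open>coeff f u = [:c:]\<close> by auto
  have "\<exists>X. finite X \<and> (\<forall>x z. x \<notin> X \<longrightarrow>
     poly2 psi (x, z) = poly (coeff psi u) x * (\<Prod>t\<in>#proots (pen x). z - poly H t / poly G t))"
    by (rule generic_factorization[of psi "{}"]) (simp_all add: psi)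
  then obtain Y where Y: "finite Y" "\<And>x z. x \<notin> Y \<Longrightarrow>
     poly2 psi (x, z) = (\<Prod>t\<in>#proots (pen x). z - poly H t / poly G t)"
    using psi(2) by auto
  have eq: "f = smult [:c:] psi"
  proof (rule ccontr)
    assume "f \<noteq> smult [:c:] psi"
    then have "f - smult [:c:] psi \<noteq> 0" by simp
    then obtain x z where "x \<notin> X \<union> Y" "z \<notin> X \<union> Y" "poly2 (f - smult [:c:] psi) (x, z) \<noteq> 0"
      by (rule poly2_nonzero_point[OF _ finite_UnI[OF X(1) Y(1)]])
    then show False using X(2)[of x z] Y(2)[of x z] by (simp add: poly2_def)
  qed
  moreover have "c \<noteq> 0" using eq f(1) by auto
  ultimately show thesis using that by blast
qed

text \<open>The transform of \<open>psi\<close> lies in the vanishing ideal and is thus a multiple of \<open>\<phi>\<close>.  This is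
  used only to bound the total degree of \<open>\<phi>\<close>; the converse transform of \<open>\<phi>\<close> is then a constant
  multiple of \<open>psi\<close> by uniqueness, and supports can be compared.\<close>

theorem implicit_equation_support:
  fixes P :: "nat \<Rightarrow> complex poly"
  assumes chart: "is_chart i k j" and P: "P i = F" "P j = G" "P k = H"
    and \<phi>: "is_implicit_equation (P 0) (P 1) (P 2) \<phi>"
  shows "supp2 \<phi> \<subseteq> tri u" and "rechart u 0 1 i k ` supp2 \<phi> = supp2 psi"
proof -
  have std: "is_chart 0 1 2" by (simp add: is_chart_def)
  have Pnz: "P l \<noteq> 0" if "l \<in> {0, 1, 2}" for l
  proof -
    have "l \<in> {i, k, j}" using chart that by (simp add: is_chart_def)
    then show ?thesis using P F0 G0 H0 by auto
  qed
  have fin: "finite {t. poly (P 2) t = 0}" "finite {t. poly G t = 0}"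
    using Pnz[of 2] G0 poly_roots_finite by auto
  have psi_tri: "supp2 psi \<subseteq> tri u" using psi_total_degree by (auto simp: tri_def)
  define \<psi>' where "\<psi>' = chart_change u i k 0 1 psi"
  have psi0: "form_eval u i k psi (\<lambda>l. poly (P l) t) = 0" for t
  proof (rule form_eval_vanish_cofinite[OF fin(2)])
    fix t assume t: "t \<notin> {t. poly G t = 0}"
    show "form_eval u i k psi (\<lambda>l. poly (P l) t) = 0"
      by (rule form_eval_eq_0_iff[OF chart psi_tri, THEN iffD2]) (use t psi(3) in \<open>simp_all add: P\<close>)
  qed
  have "poly2 \<psi>' (param_point (P 0) (P 1) (P 2) t) = 0" if t: "poly (P 2) t \<noteq> 0" for t
  proof -
    have "form_eval u 0 1 \<psi>' (\<lambda>l. poly (P l) t) = 0"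
      unfolding \<psi>'_def form_eval_chart_change[OF chart std] by (rule psi0)
    then show ?thesis
      using form_eval_eq_0_iff[where X = "\<lambda>l. poly (P l) t", OF std supp2_chart_change t]
      unfolding \<psi>'_def param_point_def by blast
  qed
  then have "\<phi> dvd \<psi>'"
    using \<phi> unfolding is_implicit_equation_def vanishing_ideal_def by blast
  then obtain \<eta> where \<eta>: "\<psi>' = \<phi> * \<eta>" by (elim dvdE)
  have "\<psi>' \<noteq> 0"
  proof -
    have "rechart u i k 0 1 (0, u) \<in> tri u" by (rule rechart_tri[OF chart std]) (simp add: tri_def)
    moreover have "rechart u 0 1 i k (rechart u i k 0 1 (0, u)) = (0, u)"
      by (rule rechart_rechart[OF chart std]) (simp add: tri_def)
    ultimately have "coeff2 \<psi>' (rechart u i k 0 1 (0, u)) \<noteq> 0"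
      using psi(2) by (simp add: \<psi>'_def coeff2_chart_change)
    then show ?thesis by auto
  qed
  then have \<phi>0: "\<phi> \<noteq> 0" using \<eta> by auto
  show \<phi>tri: "supp2 \<phi> \<subseteq> tri u"
  proof (rule supp2_factor_tri)
    show "\<phi> * \<eta> \<noteq> 0" using \<open>\<psi>' \<noteq> 0\<close> unfolding \<eta> .
    show "supp2 (\<phi> * \<eta>) \<subseteq> tri u"
      unfolding \<eta>[symmetric] unfolding \<psi>'_def by (rule supp2_chart_change)
  qed
  define \<phi>' where "\<phi>' = chart_change u 0 1 i k \<phi>"
  have "\<phi> \<in> vanishing_ideal (P 0) (P 1) (P 2)"
    using \<phi> unfolding is_implicit_equation_def by simp
  then have van: "poly2 \<phi> (param_point (P 0) (P 1) (P 2) t) = 0" if "poly (P 2) t \<noteq> 0" for t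
    using that unfolding vanishing_ideal_def by blast
  have phi0: "form_eval u 0 1 \<phi> (\<lambda>l. poly (P l) t) = 0" for t
  proof (rule form_eval_vanish_cofinite[OF fin(1)])
    fix t assume "t \<notin> {t. poly (P 2) t = 0}"
    then have t: "poly (P 2) t \<noteq> 0" by simp
    show "form_eval u 0 1 \<phi> (\<lambda>l. poly (P l) t) = 0"
      using form_eval_eq_0_iff[where X = "\<lambda>l. poly (P l) t", OF std \<phi>tri t] van[OF t]
      unfolding param_point_def by blast
  qed
  have coeff: "coeff2 \<phi>' (rechart u 0 1 i k e) = coeff2 \<phi> e" if "e \<in> tri u" for e
    using rechart_tri[OF std chart that] rechart_rechart[OF std chart that]
    by (simp add: \<phi>'_def coeff2_chart_change)
  have "\<phi>' \<noteq> 0"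
  proof
    assume "\<phi>' = 0"
    then have "coeff2 \<phi> e = 0" for e
      using coeff[of e] \<phi>tri by (cases "e \<in> tri u") (auto simp: supp2_iff)
    then have "coeff (coeff \<phi> q) p = 0" for p q by (metis fst_conv snd_conv)
    with \<phi>0 show False by (simp add: poly_eq_iff)
  qed
  moreover have "supp2 \<phi>' \<subseteq> tri u" unfolding \<phi>'_def by (rule supp2_chart_change)
  moreover have "poly2 \<phi>' (poly F t / poly G t, poly H t / poly G t) = 0" if t: "poly G t \<noteq> 0" for t
  proof -
    have "form_eval u i k \<phi>' (\<lambda>l. poly (P l) t) = 0"
      unfolding \<phi>'_def form_eval_chart_change[OF std chart] by (rule phi0)
    then show ?thesis
      using form_eval_eq_0_iff[OF chart supp2_chart_change, where X = "\<lambda>l. poly (P l) t"] t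
      unfolding \<phi>'_def P by blast
  qed
  ultimately obtain c where c: "c \<noteq> 0" "\<phi>' = smult [:c:] psi" by (rule psi_unique)
  have "rechart u 0 1 i k ` supp2 \<phi> = supp2 \<phi>'"
  proof (intro equalityI subsetI)
    fix d assume "d \<in> rechart u 0 1 i k ` supp2 \<phi>"
    then show "d \<in> supp2 \<phi>'" using coeff \<phi>tri by (auto simp: supp2_iff)
  next
    fix d assume d: "d \<in> supp2 \<phi>'"
    then have dt: "d \<in> tri u" using \<open>supp2 \<phi>' \<subseteq> tri u\<close> by blast
    define e where "e = rechart u i k 0 1 d"
    have e: "e \<in> tri u" "rechart u 0 1 i k e = d"
      unfolding e_def using rechart_tri[OF chart std dt] rechart_rechart[OF chart std dt] by auto
    then have "e \<in> supp2 \<phi>" using coeff[OF e(1)] d by (simp add: supp2_iff)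
    then show "d \<in> rechart u 0 1 i k ` supp2 \<phi>" using e(2) by force
  qed
  also have "\<dots> = supp2 psi" using c by (auto simp: supp2_iff)
  finally show "rechart u 0 1 i k ` supp2 \<phi> = supp2 psi" .
qed

end

section \<open>Generic coefficients\<close>

lemma coeff_supp_poly: "finite (A l) \<Longrightarrow> coeff (supp_poly A c l) n = (if n \<in> A l then c (l, n) else 0)"
  by (simp add: supp_poly_def coeff_sum)

lemma topspace_coeff_space:
  "topspace (coeff_space A) = {c \<in> extensional (coeff_index A). \<forall>x\<in>coeff_index A. c x \<noteq> 0}"
  by (auto simp: coeff_space_def PiE_def Pi_def)

lemma coeff_space_nonzero:
  "c \<in> topspace (coeff_space A) \<Longrightarrow> l \<in> {0, 1, 2} \<Longrightarrow> n \<in> A l \<Longrightarrow> c (l, n) \<noteq> 0"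
  unfolding topspace_coeff_space coeff_index_def by blast

lemma continuous_map_coordinate:
  assumes "x \<in> coeff_index A"
  shows "continuous_map (coeff_space A) euclidean (\<lambda>c. c x)"
proof -
  have "continuous_map (coeff_space A) (top_of_set (- {0})) (\<lambda>c. c x)"
    unfolding coeff_space_def by (rule continuous_map_product_projection[OF assms])
  then show ?thesis by (simp add: continuous_map_in_subtopology)
qed

text \<open>The polynomial without its factor \<open>t\<close>, to the power \<open>bL A l\<close>.  Its degree is the same for all
  coefficient vectors, which makes the resultant a continuous function of them.\<close>

definition shifted_poly :: "(nat \<Rightarrow> nat set) \<Rightarrow> (nat \<times> nat \<Rightarrow> complex) \<Rightarrow> nat \<Rightarrow> complex poly" where
  "shifted_poly A c l = (\<Sum>n\<in>A l. monom (c (l, n)) (n - bL A l))"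

definition good_coeffs :: "(nat \<Rightarrow> nat set) \<Rightarrow> (nat \<times> nat \<Rightarrow> complex) set" where
  "good_coeffs A = {c \<in> topspace (coeff_space A).
     \<forall>t. poly (supp_poly A c 0) t = 0 \<longrightarrow> poly (supp_poly A c 1) t = 0 \<longrightarrow> t = 0}"

context
  fixes A :: "nat \<Rightarrow> nat set"
  assumes supports: "\<forall>l\<in>{0, 1, 2}. finite (A l) \<and> A l \<noteq> {}"
begin

lemma supp_finite: "l \<in> {0, 1, 2} \<Longrightarrow> finite (A l)"
  and supp_nonempty: "l \<in> {0, 1, 2} \<Longrightarrow> A l \<noteq> {}"
  using supports by blast+

lemma bL_le_bR:
  assumes "l \<in> {0, 1, 2}"
  shows "bL A l \<in> A l" "bR A l \<in> A l" "bL A l \<le> bR A l" "n \<in> A l \<Longrightarrow> bL A l \<le> n" "n \<in> A l \<Longrightarrow> n \<le> bR A l"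
  using supp_finite[OF assms] supp_nonempty[OF assms] by (simp_all add: bL_def bR_def)

lemma supp_poly_degree_order:
  assumes c: "c \<in> topspace (coeff_space A)" and l: "l \<in> {0, 1, 2}"
  shows "degree (supp_poly A c l) = bR A l" "order 0 (supp_poly A c l) = bL A l"
    "supp_poly A c l \<noteq> 0"
proof -
  note co = coeff_supp_poly[of A l c, OF supp_finite[OF l]]
  have R: "coeff (supp_poly A c l) (bR A l) \<noteq> 0"
    using bL_le_bR(2)[OF l] coeff_space_nonzero[OF c l] by (simp add: co)
  then show "supp_poly A c l \<noteq> 0" by auto
  have "coeff (supp_poly A c l) n = 0" if "n > bR A l" for n
    using bL_le_bR(5)[OF l, of n] that by (auto simp: co)
  then have "degree (supp_poly A c l) \<le> bR A l" by (intro degree_le) auto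
  then show "degree (supp_poly A c l) = bR A l" using le_degree[OF R] by simp
  show "order 0 (supp_poly A c l) = bL A l"
  proof (rule order_0_supp)
    show "coeff (supp_poly A c l) (bL A l) \<noteq> 0"
      using bL_le_bR(1)[OF l] coeff_space_nonzero[OF c l] by (simp add: co)
    show "coeff (supp_poly A c l) m = 0" if "m < bL A l" for m
      using bL_le_bR(4)[OF l, of m] that by (auto simp: co)
  qed
qed

lemma coeff_shifted_poly:
  assumes l: "l \<in> {0, 1, 2}"
  shows "coeff (shifted_poly A c l) m = (if m + bL A l \<in> A l then c (l, m + bL A l) else 0)"
proof -
  have "coeff (monom (c (l, n)) (n - bL A l)) m = (if n = m + bL A l then c (l, m + bL A l) else 0)"
    if "n \<in> A l" for n
    using bL_le_bR(4)[OF l that] by auto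
  then have "coeff (shifted_poly A c l) m = (\<Sum>n\<in>A l. if n = m + bL A l then c (l, m + bL A l) else 0)"
    unfolding shifted_poly_def coeff_sum by (intro sum.cong refl) blast
  then show ?thesis using supp_finite[OF l] by simp
qed

lemma supp_poly_eq_shifted:
  assumes l: "l \<in> {0, 1, 2}"
  shows "supp_poly A c l = monom 1 (bL A l) * shifted_poly A c l"
proof (rule poly_eqI)
  fix m
  show "coeff (supp_poly A c l) m = coeff (monom 1 (bL A l) * shifted_poly A c l) m"
    unfolding coeff_monom_mult coeff_shifted_poly[OF l] coeff_supp_poly[of A l c, OF supp_finite[OF l]]
    using bL_le_bR(4)[OF l, of m] by auto
qed

lemma shifted_poly_props:
  assumes c: "c \<in> topspace (coeff_space A)" and l: "l \<in> {0, 1, 2}"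
  shows "degree (shifted_poly A c l) = bR A l - bL A l" "poly (shifted_poly A c l) 0 \<noteq> 0"
proof -
  show 0: "poly (shifted_poly A c l) 0 \<noteq> 0"
    using bL_le_bR(1)[OF l] coeff_space_nonzero[OF c l]
    by (simp add: poly_0_coeff_0 coeff_shifted_poly[OF l])
  then have "shifted_poly A c l \<noteq> 0" by auto
  then have "bR A l = bL A l + degree (shifted_poly A c l)"
    using supp_poly_degree_order(1)[OF c l] unfolding supp_poly_eq_shifted[OF l]
    by (simp add: degree_mult_eq degree_monom_eq monom_eq_0_iff)
  then show "degree (shifted_poly A c l) = bR A l - bL A l" by simp
qed

lemma good_coeffs_iff_resultant:
  assumes c: "c \<in> topspace (coeff_space A)"
  shows "c \<in> good_coeffs A \<longleftrightarrow> resultant (shifted_poly A c 0) (shifted_poly A c 1) \<noteq> 0"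
proof -
  let ?f = "shifted_poly A c 0" and ?g = "shifted_poly A c 1"
  have f0: "poly ?f 0 \<noteq> 0" "?f \<noteq> 0" and g0: "poly ?g 0 \<noteq> 0"
    using shifted_poly_props(2)[OF c, of 0] shifted_poly_props(2)[OF c, of 1] by auto
  have "c \<in> good_coeffs A \<longleftrightarrow> (\<forall>t. \<not> (poly ?f t = 0 \<and> poly ?g t = 0))"
  proof -
    have root: "poly (supp_poly A c l) t = 0 \<longleftrightarrow> poly (shifted_poly A c l) t = 0"
      if "l \<in> {0, 1, 2}" "t \<noteq> 0" for l t
      unfolding supp_poly_eq_shifted[OF that(1)] using that(2) by (simp add: poly_monom)
    have "c \<in> good_coeffs A \<longleftrightarrow> (\<forall>t. t \<noteq> 0 \<longrightarrow> \<not> (poly ?f t = 0 \<and> poly ?g t = 0))"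
      unfolding good_coeffs_def using c root[of 0] root[of 1] by auto
    then show ?thesis using f0(1) by metis
  qed
  also have "\<dots> \<longleftrightarrow> degree (gcd ?f ?g) = 0"
  proof
    assume "\<forall>t. \<not> (poly ?f t = 0 \<and> poly ?g t = 0)"
    then have "coprime ?f ?g" by (intro no_common_root_imp_coprime[OF f0(2)]) blast
    then show "degree (gcd ?f ?g) = 0" by (simp add: coprime_iff_gcd_eq_1)
  next
    assume d: "degree (gcd ?f ?g) = 0"
    show "\<forall>t. \<not> (poly ?f t = 0 \<and> poly ?g t = 0)"
    proof (intro allI notI, elim conjE)
      fix t assume "poly ?f t = 0" "poly ?g t = 0"
      then have dv: "[:-t, 1:] dvd gcd ?f ?g" by (simp add: poly_eq_0_iff_dvd)
      moreover have "gcd ?f ?g \<noteq> 0" using f0 by simp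
      ultimately have "degree [:-t, 1:] \<le> degree (gcd ?f ?g)" by (rule dvd_imp_degree_le)
      with d show False by simp
    qed
  qed
  finally show ?thesis using resultant_0_gcd[of ?f ?g] by simp
qed

lemma continuous_map_resultant:
  "continuous_map (coeff_space A) euclidean (\<lambda>c. resultant (shifted_poly A c 0) (shifted_poly A c 1))"
proof -
  define m where "m = bR A 0 - bL A 0"
  define n where "n = bR A 1 - bL A 1"
  have coef: "continuous_map (coeff_space A) euclidean (\<lambda>c. coeff (shifted_poly A c l) k)"
    if l: "l \<in> {0, 1, 2}" for l k
    unfolding coeff_shifted_poly[OF l] using l
    by (cases "k + bL A l \<in> A l") (auto intro!: continuous_map_coordinate simp: coeff_index_def)
  have entry: "continuous_map (coeff_space A) euclidean
      (\<lambda>c. sylvester_mat_sub m n (shifted_poly A c 0) (shifted_poly A c 1) $$ (i, j))"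
    if "i < m + n" "j < m + n" for i j
    unfolding sylvester_mat_sub_index[OF that] using coef[of 0] coef[of 1] by auto
  have "continuous_map (coeff_space A) euclidean
      (\<lambda>c. resultant_sub m n (shifted_poly A c 0) (shifted_poly A c 1))"
  proof -
    have *: "resultant_sub m n f g = (\<Sum>p\<in>{p. p permutes {0..<m + n}}. signof p *
        (\<Prod>i = 0..<m + n. sylvester_mat_sub m n f g $$ (i, p i)))" for f g :: "complex poly"
      by (simp add: resultant_sub_def Determinant.det_def)
    show ?thesis unfolding * continuous_map_atin
    proof (intro ballI, unfold limitin_canonical_iff, intro tendsto_sum tendsto_mult tendsto_const tendsto_prod)
      fix c p i
      assume c: "c \<in> topspace (coeff_space A)" and p: "p \<in> {p. p permutes {0..<m + n}}" and i: "i \<in> {0..<m + n}"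
      have "p i < m + n" using p i permutes_in_image[of p "{0..<m + n}" i] by auto
      then show "((\<lambda>c. sylvester_mat_sub m n (shifted_poly A c 0) (shifted_poly A c 1) $$ (i, p i)) \<longlongrightarrow>
          sylvester_mat_sub m n (shifted_poly A c 0) (shifted_poly A c 1) $$ (i, p i)) (atin (coeff_space A) c)"
        using entry[of i "p i"] i c unfolding continuous_map_atin by auto
    qed
  qed
  then show ?thesis
    by (rule continuous_map_eq)
      (simp add: resultant_sub m_def n_def shifted_poly_props(1))
qed

lemma openin_good_coeffs: "openin (coeff_space A) (good_coeffs A)"
proof -
  have "good_coeffs A = {c \<in> topspace (coeff_space A).
      resultant (shifted_poly A c 0) (shifted_poly A c 1) \<in> - {0}}"
    using good_coeffs_iff_resultant good_coeffs_def by auto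
  also have "openin (coeff_space A) \<dots>"
    by (rule openin_continuous_map_preimage[OF continuous_map_resultant]) (simp add: open_openin[symmetric] open_Compl)
  finally show ?thesis .
qed

text \<open>Add \<open>\<epsilon>\<close> to one coefficient of \<open>P\<^sub>0\<close>.  Each nonzero root of \<open>P\<^sub>1\<close> becomes a root of the modified
  polynomial for one value of \<open>\<epsilon>\<close> only, so that almost all small \<open>\<epsilon>\<close> lead to good
  coefficients.\<close>

lemma good_coeffs_dense: "coeff_space A closure_of (good_coeffs A) = topspace (coeff_space A)"
proof (intro equalityI closure_of_subset_topspace subsetI)
  fix c assume c: "c \<in> topspace (coeff_space A)"
  define n where "n = bL A 0"
  define x where "x = ((0::nat), n)"
  have nA: "n \<in> A 0" unfolding n_def by (rule bL_le_bR) simp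
  have x: "x \<in> coeff_index A" using nA by (simp add: x_def coeff_index_def)
  define \<gamma> where "\<gamma> = (\<lambda>\<epsilon>. c(x := c x + \<epsilon>))"
  define D where "D = - {- c x}"
  have \<gamma>c: "continuous_map (top_of_set D) (coeff_space A) \<gamma>"
    unfolding coeff_space_def continuous_map_componentwise
  proof (intro conjI ballI)
    show "\<gamma> ` topspace (top_of_set D) \<subseteq> extensional (coeff_index A)"
      using c x by (auto simp: \<gamma>_def topspace_coeff_space extensional_def)
    fix y assume y: "y \<in> coeff_index A"
    show "continuous_map (top_of_set D) (top_of_set (- {0})) (\<lambda>\<epsilon>. \<gamma> \<epsilon> y)"
    proof (cases "y = x")
      case True
      have "continuous_on D (\<lambda>\<epsilon>. c x + \<epsilon>)" by (intro continuous_intros)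
      moreover have "c x + \<epsilon> \<noteq> 0" if "\<epsilon> \<in> D" for \<epsilon>
        using that by (auto simp: D_def add_eq_0_iff)
      ultimately show ?thesis using True by (auto simp: \<gamma>_def continuous_map_in_subtopology)
    next
      case False
      then show ?thesis using y c by (auto simp: \<gamma>_def topspace_coeff_space)
    qed
  qed
  have P1: "supp_poly A (\<gamma> \<epsilon>) 1 = supp_poly A c 1" for \<epsilon>
    by (simp add: supp_poly_def \<gamma>_def x_def)
  have P0: "supp_poly A (\<gamma> \<epsilon>) 0 = supp_poly A c 0 + monom \<epsilon> n" for \<epsilon>
    using nA supp_finite[of 0] by (intro poly_eqI) (auto simp: coeff_supp_poly \<gamma>_def x_def)
  define R where "R = {t. poly (supp_poly A c 1) t = 0} - {0}"
  have finR: "finite R"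
    unfolding R_def using supp_poly_degree_order(3)[OF c, of 1] poly_roots_finite by auto
  \<comment> \<open>the values of \<open>\<epsilon>\<close> for which a nonzero root of \<open>P\<^sub>1\<close> is a root of the modified \<open>P\<^sub>0\<close>\<close>
  define bad where "bad = (\<lambda>t. - poly (supp_poly A c 0) t / t ^ n) ` R"
  have good: "\<gamma> \<epsilon> \<in> good_coeffs A" if "\<epsilon> \<in> D" "\<epsilon> \<notin> bad" for \<epsilon>
  proof -
    have "\<gamma> \<epsilon> \<in> topspace (coeff_space A)"
      using continuous_map_image_subset_topspace[OF \<gamma>c] that(1) by auto
    moreover have "t = 0" if t: "poly (supp_poly A (\<gamma> \<epsilon>) 0) t = 0" "poly (supp_poly A (\<gamma> \<epsilon>) 1) t = 0" for t
    proof (rule ccontr)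
      assume t0: "t \<noteq> 0"
      then have "t \<in> R" using t(2) unfolding P1 R_def by simp
      moreover have "\<epsilon> = - poly (supp_poly A c 0) t / t ^ n"
      proof -
        have "\<epsilon> * t ^ n = - poly (supp_poly A c 0) t"
          using t(1) by (simp add: P0 poly_monom add_eq_0_iff)
        then show ?thesis using t0 by (metis nonzero_mult_div_cancel_right power_not_zero)
      qed
      ultimately show False using \<open>\<epsilon> \<notin> bad\<close> by (auto simp: bad_def)
    qed
    ultimately show ?thesis by (simp add: good_coeffs_def)
  qed
  show "c \<in> coeff_space A closure_of (good_coeffs A)"
    unfolding in_closure_of
  proof (intro conjI c allI impI, elim conjE)
    fix T assume T: "c \<in> T" "openin (coeff_space A) T"
    \<comment> \<open>A nonempty open subset of \<open>\<complex>\<close> is infinite, hence not contained in a finite set.\<close>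
    define V where "V = {\<epsilon> \<in> D. \<gamma> \<epsilon> \<in> T}"
    have "openin (top_of_set D) V"
      using openin_continuous_map_preimage[OF \<gamma>c T(2)] by (simp add: V_def)
    moreover have "open D" by (simp add: D_def open_Compl)
    ultimately have "open V" by (simp add: openin_open_eq)
    moreover have "0 \<in> V"
    proof -
      have "c x \<noteq> 0" using c x by (simp add: topspace_coeff_space)
      then show ?thesis using T(1) by (simp add: V_def D_def \<gamma>_def)
    qed
    ultimately have "infinite V" using finite_imp_not_open by blast
    then have "\<not> V \<subseteq> bad" using finR finite_subset by (auto simp: bad_def)
    then obtain \<epsilon> where "\<epsilon> \<in> V" "\<epsilon> \<notin> bad" by blast
    then show "\<exists>y. y \<in> good_coeffs A \<and> y \<in> T" using good[of \<epsilon>] by (auto simp: V_def)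
  qed
qed

end

section \<open>The Newton polygon\<close>

abbreviation cross :: "real \<times> real \<Rightarrow> real \<times> real \<Rightarrow> real" where
  "cross a b \<equiv> fst a * snd b - snd a * fst b"

text \<open>The quotients of the cross products are the barycentric coordinates.\<close>

lemma in_hull_triangle:
  assumes "cross a b > 0" "cross a x \<ge> 0" "cross x b \<ge> 0" "cross x b + cross a x \<le> cross a b"
  shows "x \<in> convex hull {(0, 0), a, b}"
proof -
  define d where "d = cross a b"
  define \<kappa> where "\<kappa> = cross x b / d"
  define \<mu> where "\<mu> = cross a x / d"
  have d: "d > 0" using assms by (simp add: d_def)
  have "\<kappa> + \<mu> \<le> 1" "\<kappa> \<ge> 0" "\<mu> \<ge> 0"
    using assms d by (simp_all add: \<kappa>_def \<mu>_def add_divide_distrib[symmetric] d_def[symmetric])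
  moreover have "x = (1 - \<kappa> - \<mu>) *\<^sub>R (0, 0) + \<kappa> *\<^sub>R a + \<mu> *\<^sub>R b"
  proof -
    have "d * fst x = cross x b * fst a + cross a x * fst b"
      "d * snd x = cross x b * snd a + cross a x * snd b"
      by (simp_all add: d_def algebra_simps)
    then have "fst x = (cross x b * fst a + cross a x * fst b) / d"
      "snd x = (cross x b * snd a + cross a x * snd b) / d"
      using d by (metis nonzero_mult_div_cancel_left less_irrefl)+
    then have "fst x = \<kappa> * fst a + \<mu> * fst b" "snd x = \<kappa> * snd a + \<mu> * snd b"
      by (simp_all only: \<kappa>_def \<mu>_def add_divide_distrib times_divide_eq_left)
    then show ?thesis by (simp add: prod_eq_iff)
  qed
  ultimately show ?thesis unfolding convex_hull_3
    by (intro CollectI exI[of _ "1 - \<kappa> - \<mu>"] exI[of _ \<kappa>] exI[of _ \<mu>]) auto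
qed

text \<open>The candidate polygon is a fan of three triangles with apex \<open>(0, 0)\<close>, some of which may be
  degenerate.  The signs of two cross products tell in which of the three cones \<open>(e, f)\<close> lies,
  and the inequality that belongs to that cone places it on the near side of the edge opposite
  to the apex.\<close>

lemma pentagon_in_hull:
  fixes e f u a b g h :: real
  assumes par: "0 < a" "a \<le> u" "0 \<le> g" "g < u" "0 \<le> b" "b \<le> h" "h \<le> u"
    and tri: "0 \<le> e" "0 \<le> f" "e + f \<le> u"
    and at_0: "a * b \<le> a * e + b * (u - e - f)"
    and at_inf: "(u - g) * (u - h) \<le> (u - g) * f + (u - h) * (u - e - f)"
  shows "(e, f) \<in> convex hull ({(g, 0), (h, u - h), (b, u - b), (0, 0)} \<union> (if b > 0 then {(0, u - a)} else {}))"
    (is "_ \<in> convex hull ?V")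
proof -
  have u: "u > 0" using par by linarith
  consider "cross (e, f) (h, u - h) > 0" | "cross (b, u - b) (e, f) > 0"
    | "cross (h, u - h) (e, f) \<ge> 0" "cross (e, f) (b, u - b) \<ge> 0"
    by (simp add: algebra_simps) linarith
  then show ?thesis
  proof cases
    case 1
    have "(e, f) \<in> convex hull {(0, 0), (g, 0), (h, u - h)}"
    proof (rule in_hull_triangle)
      show s: "cross (e, f) (h, u - h) + cross (g, 0) (e, f) \<le> cross (g, 0) (h, u - h)"
        using at_inf by (simp add: algebra_simps)
      show "cross (g, 0) (e, f) \<ge> 0" using par tri by simp
      with 1 s show "cross (g, 0) (h, u - h) > 0" by linarith
      show "cross (e, f) (h, u - h) \<ge> 0" using 1 by linarith
    qed
    then show ?thesis using hull_mono[of "{(0, 0), (g, 0), (h, u - h)}" ?V convex] by blast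
  next
    case 2
    have b: "b > 0"
    proof (rule ccontr)
      assume "\<not> b > 0"
      then have "b = 0" using par by simp
      with 2 u tri show False by (simp add: mult_less_0_iff)
    qed
    have "(e, f) \<in> convex hull {(0, 0), (b, u - b), (0, u - a)}"
    proof (rule in_hull_triangle)
      show s: "cross (e, f) (0, u - a) + cross (b, u - b) (e, f) \<le> cross (b, u - b) (0, u - a)"
        using at_0 by (simp add: algebra_simps)
      show "cross (e, f) (0, u - a) \<ge> 0" using par tri by simp
      with 2 s show "cross (b, u - b) (0, u - a) > 0" by linarith
      show "cross (b, u - b) (e, f) \<ge> 0" using 2 by linarith
    qed
    moreover have "{(0, 0), (b, u - b), (0, u - a)} \<subseteq> ?V" using b by auto
    ultimately show ?thesis using hull_mono[of "{(0, 0), (b, u - b), (0, u - a)}" ?V convex] by blast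
  next
    case 3
    have sum: "cross (e, f) (b, u - b) + cross (h, u - h) (e, f) = (e + f) * (h - b)"
      "cross (h, u - h) (b, u - b) = u * (h - b)"
      by (simp_all add: algebra_simps)
    \<comment> \<open>If \<open>h = b\<close>, the middle triangle degenerates to the segment from \<open>(0, 0)\<close> to \<open>(h, u - h)\<close>.\<close>
    show ?thesis
    proof (cases "h = b")
      case True
      with 3 have eq: "h * f = (u - h) * e" by (simp add: algebra_simps)
      define \<kappa> where "\<kappa> = (e + f) / u"
      have "0 \<le> \<kappa>" "\<kappa> \<le> 1" using u tri by (simp_all add: \<kappa>_def)
      moreover have "(e, f) = (1 - \<kappa>) *\<^sub>R (0, 0) + \<kappa> *\<^sub>R (h, u - h)"
        using u eq by (simp add: \<kappa>_def field_simps)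
      ultimately have "(e, f) \<in> convex hull {(0, 0), (h, u - h)}"
        unfolding convex_hull_2 by (intro CollectI exI[of _ "1 - \<kappa>"] exI[of _ \<kappa>]) auto
      then show ?thesis using hull_mono[of "{(0, 0), (h, u - h)}" ?V convex] by blast
    next
      case False
      then have hb: "h - b > 0" using par by simp
      have "(e, f) \<in> convex hull {(0, 0), (h, u - h), (b, u - b)}"
      proof (rule in_hull_triangle)
        show "cross (h, u - h) (b, u - b) > 0" unfolding sum using u hb by simp
        show "cross (e, f) (b, u - b) + cross (h, u - h) (e, f) \<le> cross (h, u - h) (b, u - b)"
          unfolding sum using tri hb by (intro mult_right_mono) auto
      qed (use 3 in auto)
      then show ?thesis using hull_mono[of "{(0, 0), (h, u - h), (b, u - b)}" ?V convex] by blast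
    qed
  qed
qed

lemma vertices_affine_image_subset:
  fixes L :: "real \<times> real \<Rightarrow> real \<times> real"
  assumes L: "linear L" "inj L"
    and hull: "convex hull ((\<lambda>x. w + L x) ` S) = convex hull V"
  shows "(\<lambda>x. w + L x) ` vertices (convex hull S) \<subseteq> V"
proof
  fix y assume "y \<in> (\<lambda>x. w + L x) ` vertices (convex hull S)"
  then obtain v where v: "v extreme_point_of (convex hull S)" and y: "y = w + L v"
    by (auto simp: vertices_def)
  have img: "convex hull V = (\<lambda>x. w + L x) ` (convex hull S)"
  proof -
    have "convex hull ((\<lambda>x. w + x) ` (L ` S)) = (\<lambda>x. w + x) ` (L ` (convex hull S))"
      by (simp only: convex_hull_translation convex_hull_linear_image[OF L(1)])
    then show ?thesis using hull by (simp add: image_image)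
  qed
  have "(w + L v) extreme_point_of (convex hull V)"
    unfolding extreme_point_of_def img
  proof (intro conjI ballI)
    show "w + L v \<in> (\<lambda>x. w + L x) ` (convex hull S)" using v by (auto simp: extreme_point_of_def)
    fix x' y' assume "x' \<in> (\<lambda>x. w + L x) ` (convex hull S)" "y' \<in> (\<lambda>x. w + L x) ` (convex hull S)"
    then obtain x y where xy: "x \<in> convex hull S" "y \<in> convex hull S" "x' = w + L x" "y' = w + L y"
      by auto
    have "v \<notin> open_segment x y" using v xy by (auto simp: extreme_point_of_def)
    then have "L v \<notin> open_segment (L x) (L y)"
      using open_segment_linear_image[OF L] inj_image_mem_iff[OF L(2)] by metis
    then show "w + L v \<notin> open_segment x' y'" unfolding xy by simp
  qed
  then show "y \<in> V" unfolding y by (rule extreme_point_of_convex_hull)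
qed

definition coord_linear :: "nat \<Rightarrow> real \<times> real \<Rightarrow> real" where
  "coord_linear l p = (if l = 0 then fst p else if l = 1 then snd p else - fst p - snd p)"

lemma coord_pair_affine:
  "coord_pair u i j = (\<lambda>p. (if i \<in> {0, 1} then 0 else real u, if j \<in> {0, 1} then 0 else real u)
     + (coord_linear i p, coord_linear j p))"
  by (auto simp: fun_eq_iff coord_pair_def hom_coord_def coord_linear_def)

lemma linear_coord_linear: "linear (\<lambda>p. (coord_linear i p, coord_linear j p))"
  by (rule linearI) (auto simp: coord_linear_def algebra_simps)

lemma inj_coord_linear:
  assumes "is_chart i k j"
  shows "inj (\<lambda>p. (coord_linear i p, coord_linear j p))"
  using assms by (elim is_chart_cases) (auto simp: inj_def coord_linear_def)

lemma coord_pair_rechart: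
  assumes "is_chart i k j" "e \<in> tri u"
  shows "coord_pair u i j (case e of (a, b) \<Rightarrow> (real a, real b)) =
    (case rechart u 0 1 i k e of (p, q) \<Rightarrow> (real p, real u - real p - real q))"
proof (cases e)
  case (Pair a b)
  then have "a + b \<le> u" using assms(2) by (simp add: tri_def)
  then have "real (u - a - b) = real u - real a - real b" by simp
  then show ?thesis unfolding Pair using assms(1)
    by (elim is_chart_cases) (simp_all add: coord_pair_def hom_coord_def rechart_def expo_def)
qed

context pencil
begin

definition pentagon :: "(real \<times> real) set" where
  "pentagon = {(real g, 0), (real h, real u - real h), (real b, real u - real b), (0, 0)} \<union>
     (if b > 0 then {(0, real u - real a)} else {})"

text \<open>The polygon in the coordinates \<open>(e\<^sub>i, e\<^sub>j)\<close>: an exponent \<open>(p, q)\<close> of \<open>psi\<close> has \<open>e\<^sub>i = p\<close> and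
  \<open>e\<^sub>k = q\<close>.  One inclusion is given by the inequalities, the other by the exponents on the sides.\<close>

lemma psi_newton_polygon:
  "convex hull ((\<lambda>(p, q). (real p, real u - real p - real q)) ` supp2 psi) = convex hull pentagon"
proof (intro equalityI hull_minimal convex_convex_hull subsetI)
  let ?\<Sigma> = "(\<lambda>(p, q). (real p, real u - real p - real q)) ` supp2 psi"
  have au: "a \<le> u" and bh: "b \<le> h"
    using order_degree[OF F0, of 0] order_degree[OF H0, of 0] by (simp_all add: ordF ordH degF degH)
  {
    fix x assume "x \<in> ?\<Sigma>"
    then obtain p q where pq: "(p, q) \<in> supp2 psi" and x: "x = (real p, real u - real p - real q)"
      by auto
    have tot: "p + q \<le> u" using psi_total_degree[OF pq] .
    have "(real p, real u - real p - real q) \<in> convex hull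
      ({(real g, 0), (real h, real u - real h), (real b, real u - real b), (0, 0)} \<union>
       (if real b > 0 then {(0, real u - real a)} else {}))"
    proof (rule pentagon_in_hull)
      show "real a * real b \<le> real a * real p + real b * (real u - real p - (real u - real p - real q))"
        using psi_weight_zero[OF pq] by simp
      show "(real u - real g) * (real u - real h) \<le> (real u - real g) * (real u - real p - real q)
          + (real u - real h) * (real u - real p - (real u - real p - real q))"
        using psi_weight_infinity[of "u - h" p q] pq hu gu by (simp add: algebra_simps)
    qed (use a0 au gu hu bh tot in auto)
    then show "x \<in> convex hull pentagon" by (simp add: x pentagon_def)
  }
  {
    have inc: "(real p, real u - real p - real q) \<in> convex hull ?\<Sigma>" if "(p, q) \<in> supp2 psi" for p q
      using that by (intro hull_inc) force
    have z: "(0, 0) \<in> convex hull ?\<Sigma>" using inc[OF psi_corner_top] by simp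
    have hh: "(real h, real u - real h) \<in> convex hull ?\<Sigma>" using inc[OF psi_corners_H(1)] by simp
    have bb: "(real b, real u - real b) \<in> convex hull ?\<Sigma>" using inc[OF psi_corners_H(2)] by simp
    have aa: "(0, real u - real a) \<in> convex hull ?\<Sigma>" if "b > 0"
      using inc[OF psi_corner_F[OF that]] by simp
    \<comment> \<open>If \<open>h = u\<close>, the point \<open>(g, 0)\<close> lies on the segment from \<open>(0, 0)\<close> to \<open>(u, 0)\<close>.\<close>
    have gg: "(real g, 0) \<in> convex hull ?\<Sigma>"
    proof (cases "h < u")
      case True
      from inc[OF psi_corner_G[OF this psi_total_degree]] show ?thesis using gu by (simp add: of_nat_diff)
    next
      case False
      then have "(real u, 0) \<in> convex hull ?\<Sigma>" using hh hu by simp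
      then have "(1 - real g / real u) *\<^sub>R (0, 0) + (real g / real u) *\<^sub>R (real u, 0) \<in> convex hull ?\<Sigma>"
        using z gu by (intro convexD[OF convex_convex_hull]) auto
      then show ?thesis using gu by simp
    qed
    fix x assume "x \<in> pentagon"
    then show "x \<in> convex hull ?\<Sigma>"
      unfolding pentagon_def using z hh bb gg aa by (auto split: if_splits)
  }
qed

theorem newton_polygon_vertices:
  fixes P :: "nat \<Rightarrow> complex poly"
  assumes chart: "is_chart i k j" and P: "P i = F" "P j = G" "P k = H"
    and \<phi>: "is_implicit_equation (P 0) (P 1) (P 2) \<phi>"
  shows "coord_pair u i j ` vertices (newton_polygon \<phi>) \<subseteq> pentagon"
    and "card (vertices (newton_polygon \<phi>)) \<le> card pentagon"
proof -
  define S where "S = {(real a, real b) | a b. coeff (coeff \<phi> b) a \<noteq> 0}"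
  define w where "w = (if i \<in> {0, 1} then 0 else real u, if j \<in> {0, 1} then 0 else real u)"
  define L where "L = (\<lambda>p. (coord_linear i p, coord_linear j p))"
  note supp = implicit_equation_support[OF chart P \<phi>]
  have S: "S = (\<lambda>(a, b). (real a, real b)) ` supp2 \<phi>"
    by (auto simp: S_def supp2_def)
  have cp: "coord_pair u i j = (\<lambda>x. w + L x)"
    unfolding coord_pair_affine w_def L_def ..
  have "coord_pair u i j ` S = (\<lambda>(p, q). (real p, real u - real p - real q)) ` supp2 psi"
    unfolding S supp(2)[symmetric] image_image by (rule image_cong[OF refl coord_pair_rechart[OF chart]]) (use supp(1) in blast)
  then have "convex hull ((\<lambda>x. w + L x) ` S) = convex hull pentagon"
    using psi_newton_polygon by (simp add: cp)
  then have "(\<lambda>x. w + L x) ` vertices (convex hull S) \<subseteq> pentagon"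
    unfolding L_def by (rule vertices_affine_image_subset[OF linear_coord_linear inj_coord_linear[OF chart]])
  then show sub: "coord_pair u i j ` vertices (newton_polygon \<phi>) \<subseteq> pentagon"
    by (simp add: cp newton_polygon_def S_def)
  have injL: "inj L" unfolding L_def by (rule inj_coord_linear[OF chart])
  have "inj (coord_pair u i j)"
    unfolding cp by (rule injI, drule add_left_imp_eq, erule injD[OF injL])
  then have "card (vertices (newton_polygon \<phi>)) = card (coord_pair u i j ` vertices (newton_polygon \<phi>))"
    by (rule card_image[OF inj_on_subset[OF _ subset_UNIV], symmetric])
  also have "\<dots> \<le> card pentagon" by (rule card_mono[OF _ sub]) (simp add: pentagon_def)
  finally show "card (vertices (newton_polygon \<phi>)) \<le> card pentagon" .
qed

end

lemma coprime_no_common_root: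
  fixes f g :: "complex poly"
  assumes "coprime f g" "poly f t = 0"
  shows "poly g t \<noteq> 0"
proof
  assume "poly g t = 0"
  then have "[:-t, 1:] dvd f" "[:-t, 1:] dvd g" using assms by (simp_all add: poly_eq_0_iff_dvd)
  then have "is_unit [:-t, 1:]" using assms(1) by (auto dest: coprime_common_divisor)
  then show False by (simp add: is_unit_iff_degree)
qed

lemma newton_segment_full:
  assumes "finite (A l)" "A l \<noteq> {}" "bL A l = 0" "bR A l = u"
  shows "newton_segment (A l) = {0..real u}"
proof
  have mem: "0 \<in> A l" "u \<in> A l" and le: "\<And>n. n \<in> A l \<Longrightarrow> n \<le> u"
    using assms Min_in[of "A l"] Max_in[of "A l"] by (auto simp: bL_def bR_def)
  show "newton_segment (A l) \<subseteq> {0..real u}"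
    unfolding newton_segment_def by (rule hull_minimal) (auto simp: le)
  have "{0..real u} = closed_segment 0 (real u)" by (simp add: closed_segment_eq_real_ivl)
  also have "\<dots> = convex hull {0, real u}" by (rule segment_convex_hull)
  also have "\<dots> \<subseteq> newton_segment (A l)"
    unfolding newton_segment_def using mem by (intro hull_mono) force
  finally show "{0..real u} \<subseteq> newton_segment (A l)" .
qed

lemma max_deg_props:
  shows "l \<in> {0, 1, 2} \<Longrightarrow> bR A l \<le> max_deg A"
    and "bR A 0 = max_deg A \<or> bR A 1 = max_deg A \<or> bR A 2 = max_deg A"
proof -
  show "l \<in> {0, 1, 2} \<Longrightarrow> bR A l \<le> max_deg A" unfolding max_deg_def by (intro Max_ge) auto
  have "max_deg A \<in> {bR A 0, bR A 1, bR A 2}" unfolding max_deg_def by (rule Max_in) auto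
  then show "bR A 0 = max_deg A \<or> bR A 1 = max_deg A \<or> bR A 2 = max_deg A" by auto
qed

text \<open>An index with \<open>bR = u\<close> has \<open>bL > 0\<close>, as its segment is not full, and can serve as \<open>i\<close>.  The
  index \<open>2\<close> is preferred, since then coprimality makes both other segments start at \<open>0\<close>.
  Otherwise \<open>j = 2\<close>.\<close>

lemma admissible_exists:
  assumes le: "\<And>l. l \<in> {0, 1, 2} \<Longrightarrow> bL A l \<le> bR A l"
    and proper: "\<And>l. l \<in> {0, 1, 2} \<Longrightarrow> bL A l = 0 \<Longrightarrow> bR A l \<noteq> max_deg A"
    and cop: "bL A 0 = 0 \<or> bL A 2 = 0" "bL A 1 = 0 \<or> bL A 2 = 0"
  shows "\<exists>i j k. admissible A i j k \<and> (bR A 0 < max_deg A \<or> bR A 1 < max_deg A \<longrightarrow> bR A k < max_deg A)"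
proof -
  have lt: "bR A l < max_deg A" if "l \<in> {0, 1, 2}" "bL A l = 0" for l
    using proper[OF that] max_deg_props(1)[OF that(1), of A] by simp
  have pos: "0 < bL A l" if "l \<in> {0, 1, 2}" "bR A l = max_deg A" for l
    using lt[OF that(1)] that(2) by (cases "bL A l = 0") auto
  have le': "bL A 0 \<le> bR A 0" "bL A 1 \<le> bR A 1" "bL A 2 \<le> bR A 2"
    "bR A 0 \<le> max_deg A" "bR A 1 \<le> max_deg A" "bR A 2 \<le> max_deg A"
    using le max_deg_props(1) by auto
  show ?thesis
  proof (cases "bR A 2 = max_deg A")
    case True
    then have "0 < bL A 2" by (intro pos) auto
    then have z: "bL A 0 = 0" "bL A 1 = 0" using cop by auto
    have "admissible A 2 0 1" using True \<open>0 < bL A 2\<close> z lt[of 0] le' by (auto simp: admissible_def)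
    moreover have "bR A 1 < max_deg A" using lt[of 1] z by simp
    ultimately show ?thesis by blast
  next
    case False
    then have R2: "bR A 2 < max_deg A" using max_deg_props(1)[of 2 A] by simp
    show ?thesis
    proof (cases "bR A 0 = max_deg A")
      case True
      then have "0 < bL A 0" by (intro pos) auto
      then have "admissible A 0 2 1" using True cop R2 le' by (auto simp: admissible_def)
      moreover have "bR A 0 < max_deg A \<or> bR A 1 < max_deg A \<longrightarrow> bR A 1 < max_deg A" using True by simp
      ultimately show ?thesis by blast
    next
      case False
      then have R1: "bR A 1 = max_deg A" using max_deg_props(2)[of A] R2 by auto
      then have "0 < bL A 1" by (intro pos) auto
      then have "admissible A 1 2 0" using R1 cop R2 le' by (auto simp: admissible_def)
      moreover have "bR A 0 < max_deg A" using False max_deg_props(1)[of 0 A] by simp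
      ultimately show ?thesis by blast
    qed
  qed
qed

text \<open>Equality in one chart means that the homogeneous coordinates at \<open>s\<close> are proportional to
  those at \<open>t\<close>, and then the points are equal in the chart of the parameterization, too.\<close>

lemma degree_one_injective:
  fixes P :: "nat \<Rightarrow> complex poly"
  assumes chart: "is_chart i k j"
    and card: "card {s. poly (P 2) s \<noteq> 0 \<and> param_point (P 0) (P 1) (P 2) s = param_point (P 0) (P 1) (P 2) t} = 1"
    and t: "poly (P 2) t \<noteq> 0"
    and j: "poly (P j) s \<noteq> 0" "poly (P j) t \<noteq> 0"
    and eq: "poly (P i) s / poly (P j) s = poly (P i) t / poly (P j) t"
      "poly (P k) s / poly (P j) s = poly (P k) t / poly (P j) t"
  shows "s = t"
proof -
  \<comment> \<open>the factor of proportionality\<close>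
  define r where "r = poly (P j) s / poly (P j) t"
  have r: "r \<noteq> 0" using j by (simp add: r_def)
  have "poly (P i) s = r * poly (P i) t" "poly (P k) s = r * poly (P k) t"
    "poly (P j) s = r * poly (P j) t"
    using eq j by (simp_all add: r_def field_simps)
  then have "poly (P l) s = r * poly (P l) t" if "l \<in> {i, k, j}" for l
    using that by blast
  then have scale: "poly (P l) s = r * poly (P l) t" if "l \<in> {0, 1, 2}" for l
    using that chart unfolding is_chart_def by blast
  define M where
    "M = {s. poly (P 2) s \<noteq> 0 \<and> param_point (P 0) (P 1) (P 2) s = param_point (P 0) (P 1) (P 2) t}"
  have "s \<in> M" "t \<in> M"
    using scale[of 0] scale[of 1] scale[of 2] r t by (simp_all add: M_def param_point_def)
  moreover obtain v where "M = {v}"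
    using card unfolding M_def[symmetric] by (rule card_1_singletonE)
  ultimately show ?thesis by simp
qed

theorem theorem17:
  fixes A :: "nat \<Rightarrow> nat set" and u :: nat
  assumes fin: "\<And>l. l \<in> {0, 1, 2} \<Longrightarrow> finite (A l)"
    and nonempty: "\<And>l. l \<in> {0, 1, 2} \<Longrightarrow> A l \<noteq> {}"
    and u: "u = max_deg A"
    and no_full: "\<And>l. l \<in> {0, 1, 2} \<Longrightarrow> newton_segment (A l) \<noteq> {0..real u}"
  shows "\<exists>U. open_dense_in (coeff_space A) U \<and>
    (\<forall>c\<in>U. \<forall>P0 P1 Q.
      P0 = supp_poly A c 0 \<longrightarrow> P1 = supp_poly A c 1 \<longrightarrow> Q = supp_poly A c 2 \<longrightarrow>
      coprime P0 Q \<longrightarrow> coprime P1 Q \<longrightarrow> has_param_degree P0 P1 Q 1 \<longrightarrow>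
        (\<exists>i j k. admissible A i j k \<and> (bR A 0 < u \<or> bR A 1 < u \<longrightarrow> bR A k < u)) \<and>
        (\<forall>\<phi> i j k. is_implicit_equation P0 P1 Q \<phi> \<longrightarrow> admissible A i j k \<longrightarrow>
          (bL A k > 0 \<longrightarrow>
            card (vertices (newton_polygon \<phi>)) \<le> 5 \<and>
            coord_pair u i j ` vertices (newton_polygon \<phi>) \<subseteq>
              {(real (bR A j), 0), (real (bR A k), real u - real (bR A k)),
               (real (bL A k), real u - real (bL A k)), (0, real u - real (bL A i)), (0, 0)}) \<and>
          (bL A k = 0 \<longrightarrow>
            card (vertices (newton_polygon \<phi>)) \<le> 4 \<and>
            coord_pair u i j ` vertices (newton_polygon \<phi>) \<subseteq>
              {(real (bR A j), 0), (real (bR A k), real u - real (bR A k)),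
               (0, real u), (0, 0)})))"
proof -
  have supports: "\<forall>l\<in>{0, 1, 2}. finite (A l) \<and> A l \<noteq> {}" using fin nonempty by blast
  show ?thesis
  proof (rule exI[of _ "good_coeffs A"], rule conjI, goal_cases)
    case 1
    show ?case
      unfolding open_dense_in_def
      by (rule conjI[OF openin_good_coeffs[OF supports] good_coeffs_dense[OF supports]])
  next
    case 2
    show ?case
    proof (intro ballI allI impI conjI)
      fix c P0 P1 Q
      assume c: "c \<in> good_coeffs A" and P: "P0 = supp_poly A c 0" "P1 = supp_poly A c 1" "Q = supp_poly A c 2"
        and cop: "coprime P0 Q" "coprime P1 Q" and deg1: "has_param_degree P0 P1 Q 1"
      define p where "p = supp_poly A c"
      have P': "P0 = p 0" "P1 = p 1" "Q = p 2" using P by (simp_all add: p_def)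
      have ct: "c \<in> topspace (coeff_space A)" using c by (simp add: good_coeffs_def)
      note props = supp_poly_degree_order[OF supports ct, folded p_def]
      note bounds = bL_le_bR[OF supports]
      have root0: "poly (p l) 0 = 0 \<longleftrightarrow> bL A l > 0" if "l \<in> {0, 1, 2}" for l
        unfolding order_root using props(2,3)[OF that] by simp
      have l0: "(0::nat) \<in> {0, 1, 2}" and l1: "(1::nat) \<in> {0, 1, 2}" and l2: "(2::nat) \<in> {0, 1, 2}" by auto
      have P02: "poly (p 2) t \<noteq> 0" if "poly (p 0) t = 0" for t
        using coprime_no_common_root[OF cop(1)] that unfolding P' by blast
      have P12: "poly (p 2) t \<noteq> 0" if "poly (p 1) t = 0" for t
        using coprime_no_common_root[OF cop(2)] that unfolding P' by blast
      have P01: "t = 0" if "poly (p 0) t = 0" "poly (p 1) t = 0" for t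
        using c that unfolding good_coeffs_def p_def by blast
      have common: "t = 0" if lm: "l \<in> {0, 1, 2}" "m \<in> {0, 1, 2}" "l \<noteq> m" "poly (p l) t = 0" "poly (p m) t = 0" for l m t
      proof -
        have "l = 0 \<or> l = 1 \<or> l = 2" "m = 0 \<or> m = 1 \<or> m = 2" using lm(1,2) by blast+
        then show ?thesis using P02 P12 P01 lm(3-5) by metis
      qed
      show "\<exists>i j k. admissible A i j k \<and> (bR A 0 < u \<or> bR A 1 < u \<longrightarrow> bR A k < u)"
        unfolding u
      proof (rule admissible_exists)
        show "bL A l \<le> bR A l" if "l \<in> {0, 1, 2}" for l using bounds(3)[OF that] .
        show "bR A l \<noteq> max_deg A" if "l \<in> {0, 1, 2}" "bL A l = 0" for l
          using newton_segment_full[of A l u] fin nonempty no_full that u by blast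
        show "bL A 0 = 0 \<or> bL A 2 = 0" "bL A 1 = 0 \<or> bL A 2 = 0"
          using P02[of 0] P12[of 0] unfolding root0[OF l0] root0[OF l1] root0[OF l2] by blast+
      qed
      fix \<phi> i j k
      assume \<phi>: "is_implicit_equation P0 P1 Q \<phi>" and adm: "admissible A i j k"
      have chart: "is_chart i k j" using adm unfolding admissible_def is_chart_def by (metis insert_commute)
      have ijk: "i \<in> {0, 1, 2}" "j \<in> {0, 1, 2}" "k \<in> {0, 1, 2}" "i \<noteq> j" "j \<noteq> k" "i \<noteq> k"
      proof -
        have "i \<in> {0, 1, 2} \<and> j \<in> {0, 1, 2} \<and> k \<in> {0, 1, 2} \<and> i \<noteq> j \<and> j \<noteq> k \<and> i \<noteq> k"
          using chart by (elim is_chart_cases) simp_all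
        then show "i \<in> {0, 1, 2}" "j \<in> {0, 1, 2}" "k \<in> {0, 1, 2}" "i \<noteq> j" "j \<noteq> k" "i \<noteq> k"
          by blast+
      qed
      define E where "E = {t. poly Q t = 0} \<union>
        {t. poly Q t \<noteq> 0 \<and> card {s. poly Q s \<noteq> 0 \<and> param_point P0 P1 Q s = param_point P0 P1 Q t} \<noteq> 1}"
      have finE: "finite E"
        using deg1 poly_roots_finite[of Q] props(3)[of 2] unfolding E_def has_param_degree_def P' by simp
      have j0: "poly (p j) 0 \<noteq> 0" using root0[OF ijk(2)] adm by (simp add: admissible_def)
      interpret pencil "p i" "p j" "p k" u "bR A j" "bR A k" "bL A i" "bL A k" E
      proof
        show "degree (p i) = u" using props(1)[OF ijk(1)] adm u by (simp add: admissible_def)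
        show "bR A j < u" "bR A k \<le> u" "0 < bL A i" using adm u by (simp_all add: admissible_def)
        show "poly (p i) t \<noteq> 0" if "poly (p j) t = 0" for t
          using common[OF ijk(1,2,4), of t] that j0 by metis
        show "poly (p k) t \<noteq> 0" if "poly (p j) t = 0" for t
          using common[OF ijk(2,3,5), of t] that j0 by metis
        show "t = 0" if "poly (p i) t = 0" "poly (p k) t = 0" for t
          using common[OF ijk(1,3,6) that] .
        show "s = t" if "poly (p j) s \<noteq> 0" "poly (p j) t \<noteq> 0" "t \<notin> E"
          "poly (p i) s / poly (p j) s = poly (p i) t / poly (p j) t"
          "poly (p k) s / poly (p j) s = poly (p k) t / poly (p j) t" for s t
        proof -
          have t: "poly (p 2) t \<noteq> 0"
            "card {s. poly (p 2) s \<noteq> 0 \<and> param_point (p 0) (p 1) (p 2) s = param_point (p 0) (p 1) (p 2) t} = 1"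
            using that(3) unfolding E_def P' by auto
          show ?thesis
            by (rule degree_one_injective[where P = p, OF chart t(2,1) that(1,2,4,5)])
        qed
      qed (rule props(1)[OF ijk(2)] props(1)[OF ijk(3)] props(2)[OF ijk(1)] props(2)[OF ijk(3)]
          props(3)[OF ijk(3)] finE)+
      have \<phi>': "is_implicit_equation (p 0) (p 1) (p 2) \<phi>" using \<phi> unfolding P' .
      note main = newton_polygon_vertices[where P = p, OF chart refl refl refl \<phi>']
      {
        assume b: "bL A k > 0"
        let ?V = "{(real (bR A j), 0), (real (bR A k), real u - real (bR A k)),
           (real (bL A k), real u - real (bL A k)), (0, real u - real (bL A i)), (0, 0)}"
        have V: "pentagon = ?V" using b by (auto simp: pentagon_def)
        have "card ?V \<le> 5" by (simp add: card_insert_if)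
        then show "card (vertices (newton_polygon \<phi>)) \<le> 5" using main(2) unfolding V by linarith
        show "coord_pair u i j ` vertices (newton_polygon \<phi>) \<subseteq> ?V" using main(1) unfolding V .
      }
      {
        assume b: "bL A k = 0"
        let ?V = "{(real (bR A j), 0), (real (bR A k), real u - real (bR A k)), (0, real u), (0, 0)}"
        have V: "pentagon = ?V" unfolding pentagon_def using b by simp
        have "card ?V \<le> 4" by (simp add: card_insert_if)
        then show "card (vertices (newton_polygon \<phi>)) \<le> 4" using main(2) unfolding V by linarith
        show "coord_pair u i j ` vertices (newton_polygon \<phi>) \<subseteq> ?V" using main(1) unfolding V .
      }
    qed
  qed
qed

end
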